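(* Consider the model $y = X\beta + Rz$ and the finite collection of linear estimators $\hat\beta_m = \Psi_m y$, $m\in\mathcal{M}$, of $\beta$. Fix $\theta\in(0,1)$ and for all $m\in\mathcal{M}$ put $$A_m = R^T\big(-\theta\,\Psi_m^TX^TX\Psi_m + X\Psi_m + \Psi_m^TX^T\big)R,\qquad B_m = (\theta X\Psi_m-I_n)\,R R^T\,(\theta X\Psi_m-I_n)^T.$$ Let $s_m^+$ be the largest positive eigenvalue of the symmetric matrix $A_m$ (with $s_m^+=0$ if $A_m$ has no positive eigenvalue) and let $r_m^*$ be the largest singular value of $B_m$. Associate to each $m\in\mathcal{M}$ two positive real numbers $L_m$ and $h_m$, with $\Sigma := \sum_{m\in\mathcal{M}}\exp(-L_m)<\infty$, let $\lambda>0$, and put $$Q_m = 2\,\mathrm{tr}\big(R^TX\Psi_m R\big) - \theta\|X\Psi_m R\|^2 + 2\Big(\frac{r_m^*}{\theta}+s_m^+\Big)L_m + 2\|A_m\|\sqrt{L_m+h_m} + \lambda\Big(\frac{\|A_m\|}{\sqrt{L_m}+\sqrt{L_m+h_m}}+\frac{r_m^*}{\theta}+s_m^+\Big)^2 .$$ Then for every penalty function $\mathrm{pen}:\mathcal{M}\to\mathbb{R}$, the selected estimator $\tilde\beta = \hat\beta_{\tilde m}$, where $\tilde m$ minimizes over $m\in\mathcal{M}$ the criterion $$\mathrm{Crit}(m) = y^T\big(\Psi_m^TX^TX\Psi_m - 2X\Psi_m\big)y + \mathrm{pen}(m),$$ satisfies $$(1-\theta)\,\mathbb{E}\big[\|X\tilde\beta-X\beta\|^2\big]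 \le \inf_{m\in\mathcal{M}}\Big\{\|X\beta\|^2 + (X\beta)^T\big(\Psi_m^TX^TX\Psi_m - 2X\Psi_m\big)(X\beta) + \|X\Psi_mR\|^2 - 2\,\mathrm{tr}\big(R^TX\Psi_mR\big) + \mathrm{pen}(m)\Big\} + \sup_{m\in\mathcal{M}}\big\{Q_m-\mathrm{pen}(m)\big\} + \frac{2\Sigma}{\lambda}.$$
   Context: Setting: $\beta\in\mathbb{R}^p$ is an unknown deterministic vector, $X$ is a known real $n\times p$ matrix (arbitrary $n,p$, arbitrary rank), $R$ is a known real $n\times n$ matrix, $z$ is an $n$-dimensional random vector with i.i.d. $N(0,1)$ components, and $y=X\beta+Rz$ is the observation. $\mathcal{M}$ is a finite nonempty index set, and for each $m\in\mathcal{M}$, $\Psi_m$ is a given deterministic real $p\times n$ matrix. $I_n$ is the $n\times n$ identity matrix. For vectors, $\|\cdot\|$ is the Euclidean norm; for matrices, $\|\cdot\|$ is the Euclidean (Frobenius) norm, $\|A\|^2=\sum_{i,j}a_{ij}^2$. The penalty function is deterministic: it does not depend on the data $y$. $\tilde m$ is a (measurable) choice of minimizer of $\mathrm{Crit}$ over $\mathcal{M}$. *)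

theory Defs
  imports "HOL-Probability.Probability"
begin

text \<open>
  Matrices with \<open>n\<close> rows and \<open>p\<close> columns have type \<^typ>\<open>real^'p^'n\<close>. The library instance of
  \<^const>\<open>norm\<close> on this type is the Frobenius norm.
\<close>

lemma norm_matrix_frobenius:
  fixes A :: "real^'p^'n"
  shows "(norm A)\<^sup>2 = (\<Sum>i\<in>UNIV. \<Sum>j\<in>UNIV. (A $ i $ j)\<^sup>2)"
  by (simp add: norm_vec_def L2_set_def sum_nonneg)

definition eigenvalues :: "real^'n^'n \<Rightarrow> real set" where
  "eigenvalues A = {e. \<exists>v. v \<noteq> 0 \<and> A *v v = e *\<^sub>R v}"

definition singular_values :: "real^'p^'n \<Rightarrow> real set" where
  "singular_values B = sqrt ` eigenvalues (transpose B ** B)"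

definition largest_pos_eigenvalue :: "real^'n^'n \<Rightarrow> real" where
  "largest_pos_eigenvalue A =
     (if \<exists>e\<in>eigenvalues A. e > 0 then Max {e \<in> eigenvalues A. e > 0} else 0)"

definition largest_singular_value :: "real^'p^'n \<Rightarrow> real" where
  "largest_singular_value B = Max (singular_values B)"

text \<open>The sets whose maxima are taken above are finite.\<close>

lemma finite_eigenvalues: "finite (eigenvalues A)"
proof -
  define v where "v e = (SOME w. w \<noteq> 0 \<and> A *v w = e *\<^sub>R w)" for e
  have v: "v e \<noteq> 0 \<and> A *v v e = e *\<^sub>R v e" if "e \<in> eigenvalues A" for e
    unfolding v_def by (rule someI_ex) (use that in \<open>simp add: eigenvalues_def\<close>)
  have inj: "inj_on v (eigenvalues A)"
  proof (rule inj_onI)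
    fix a b
    assume ab: "a \<in> eigenvalues A" "b \<in> eigenvalues A" "v a = v b"
    have "(a - b) *\<^sub>R v a = A *v v a - A *v v b"
      using v[OF ab(1), THEN conjunct2] v[OF ab(2), THEN conjunct2]
      by (simp only: ab(3) scaleR_diff_left)
    also have "\<dots> = 0"
      by (simp only: ab(3) diff_self)
    finally show "a = b"
      using v[OF ab(1), THEN conjunct1] by simp
  qed
  have lin: "\<forall>e\<in>S. c e = 0"
    if "finite S" "S \<subseteq> eigenvalues A" "(\<Sum>e\<in>S. c e *\<^sub>R v e) = 0" for S c
    using that
  proof (induction S arbitrary: c rule: finite_induct)
    case empty
    then show ?case by simp
  next
    case (insert a S)
    have s0: "c a *\<^sub>R v a + (\<Sum>e\<in>S. c e *\<^sub>R v e) = 0"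
      using insert.prems(2) insert.hyps by simp
    have "A *v (c a *\<^sub>R v a + (\<Sum>e\<in>S. c e *\<^sub>R v e)) = 0"
      using s0 by simp
    moreover have "A *v (\<Sum>e\<in>S. c e *\<^sub>R v e) = (\<Sum>e\<in>S. (c e * e) *\<^sub>R v e)"
      using insert.prems(1) v
      by (auto simp: vec.sum matrix_vector_mult_scaleR subset_iff intro!: sum.cong)
    ultimately have s1: "(c a * a) *\<^sub>R v a + (\<Sum>e\<in>S. (c e * e) *\<^sub>R v e) = 0"
      using insert.prems(1) v
      by (simp add: matrix_vector_right_distrib matrix_vector_mult_scaleR)
    have "(\<Sum>e\<in>S. (c e * (e - a)) *\<^sub>R v e)
        = ((c a * a) *\<^sub>R v a + (\<Sum>e\<in>S. (c e * e) *\<^sub>R v e))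
          - a *\<^sub>R (c a *\<^sub>R v a + (\<Sum>e\<in>S. c e *\<^sub>R v e))"
      by (simp add: right_diff_distrib scaleR_diff_left scaleR_add_right scaleR_sum_right sum_subtractf mult.commute)
    also have "\<dots> = 0"
      by (simp only: s0 s1) simp
    finally have "\<forall>e\<in>S. c e * (e - a) = 0"
      by (rule insert.IH[rotated]) (use insert.prems in simp)
    then have cS: "\<forall>e\<in>S. c e = 0"
      using insert.hyps by auto
    then have "c a *\<^sub>R v a = 0"
      using s0 by simp
    then show ?case
      using cS v insert.prems by auto
  qed
  have "independent (v ` eigenvalues A)"
    unfolding independent_explicit_finite_subsets
  proof (intro allI impI ballI)
    fix T u w
    assume T: "T \<subseteq> v ` eigenvalues A" "finite T" "(\<Sum>w\<in>T. u w *\<^sub>R w) = 0" "w \<in> T"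
    obtain S where S: "S \<subseteq> eigenvalues A" "finite S" "T = v ` S"
      using T by (meson finite_subset_image)
    have "(\<Sum>e\<in>S. u (v e) *\<^sub>R v e) = 0"
      using T(3) S inj by (simp add: sum.reindex inj_on_subset)
    then show "u w = 0"
      using lin[OF S(2,1), of "\<lambda>e. u (v e)"] S(3) T(4) by auto
  qed
  then show ?thesis
    by (rule finite_imageD[OF independent_imp_finite inj])
qed

definition noise_matrix ::
    "real \<Rightarrow> real^'p^'n \<Rightarrow> real^'n^'n \<Rightarrow> real^'n^'p \<Rightarrow> real^'n^'n" where
  "noise_matrix \<theta> X R \<Psi> =
     transpose R
       ** (- \<theta> *\<^sub>R (transpose \<Psi> ** transpose X ** X ** \<Psi>) + X ** \<Psi> + transpose \<Psi> ** transpose X)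
       ** R"

definition bias_matrix ::
    "real \<Rightarrow> real^'p^'n \<Rightarrow> real^'n^'n \<Rightarrow> real^'n^'p \<Rightarrow> real^'n^'n" where
  "bias_matrix \<theta> X R \<Psi> =
     (\<theta> *\<^sub>R (X ** \<Psi>) - mat 1) ** R ** transpose R ** transpose (\<theta> *\<^sub>R (X ** \<Psi>) - mat 1)"

definition crit_matrix :: "real^'p^'n \<Rightarrow> real^'n^'p \<Rightarrow> real^'n^'n" where
  "crit_matrix X \<Psi> = transpose \<Psi> ** transpose X ** X ** \<Psi> - 2 *\<^sub>R (X ** \<Psi>)"

definition crit :: "real^'p^'n \<Rightarrow> real^'n^'p \<Rightarrow> real \<Rightarrow> real^'n \<Rightarrow> real" where
  "crit X \<Psi> pen y = y \<bullet> (crit_matrix X \<Psi> *v y) + pen"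

text \<open>
  The parameter \<open>\<kappa>\<close> is the constant usually written lambda, which is reserved for abstraction.
\<close>

definition Q_bound ::
    "real \<Rightarrow> real \<Rightarrow> real^'p^'n \<Rightarrow> real^'n^'n \<Rightarrow> real^'n^'p \<Rightarrow> real \<Rightarrow> real \<Rightarrow> real" where
  "Q_bound \<theta> \<kappa> X R \<Psi> L h =
     (let A = noise_matrix \<theta> X R \<Psi>;
          s = largest_pos_eigenvalue A;
          r = largest_singular_value (bias_matrix \<theta> X R \<Psi>)
      in 2 * trace (transpose R ** X ** \<Psi> ** R) - \<theta> * (norm (X ** \<Psi> ** R))\<^sup>2
         + 2 * (r / \<theta> + s) * L + 2 * norm A * sqrt (L + h)
         + \<kappa> * (norm A / (sqrt L + sqrt (L + h)) + r / \<theta> + s)\<^sup>2)"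

end

theory Submission
  imports Defs
begin

text \<open>
  With \<open>f = X \<beta>\<close> and \<open>u = X \<Psi>\<^sub>m f - f\<close>, expanding the squares shows that \<open>(1 - \<theta>)\<close> times the loss is
  the criterion minus the penalty, plus \<open>\<parallel>f\<parallel>\<^sup>2\<close>, a centred term that does not depend on \<open>m\<close>, and
  \<open>z \<bullet> A\<^sub>m z + 2 (b\<^sub>m \<bullet> z) - \<theta> \<parallel>u\<parallel>\<^sup>2\<close>, where \<open>\<parallel>b\<^sub>m\<parallel>\<^sup>2 = u \<bullet> B\<^sub>m u \<le> r\<^sub>m\<^sup>* \<parallel>u\<parallel>\<^sup>2\<close>. Diagonalizing \<open>A\<^sub>m\<close> and using
  the rotation invariance of \<open>z\<close> gives the Laplace transform of this quadratic form, and hence, by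
  Chernoff's method, a tail bound in which the term containing \<open>\<parallel>b\<^sub>m\<parallel>\<close> is absorbed by \<open>\<theta> \<parallel>u\<parallel>\<^sup>2\<close>.
  At level \<open>L\<^sub>m + \<xi>\<close> the form exceeds \<open>Q\<^sub>m + \<xi>\<^sup>2 / \<kappa>\<close> with probability at most \<open>exp (- L\<^sub>m - \<xi>)\<close>; integrating
  over \<open>\<xi>\<close> bounds the expected excess over \<open>Q\<^sub>m\<close> by \<open>2 exp (- L\<^sub>m) / \<kappa>\<close>.
\<close>

section \<open>Spectral decomposition of symmetric matrices\<close>

text \<open>A maximizer of the Rayleigh quotient on the unit sphere of \<open>S\<close> exists by
  compactness and is an eigenvector by first-order optimality. An invariant subspace takes the place
  of the whole space so that the argument can be repeated on orthogonal complements.\<close>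

lemma selfadjoint_eigenvector_in_subspace:
  fixes f :: "'a::euclidean_space \<Rightarrow> 'a"
  assumes lin: "linear f" and sym: "\<And>x y. f x \<bullet> y = x \<bullet> f y"
    and S: "subspace S" "f ` S \<subseteq> S" "S \<noteq> {0}"
  obtains v e where "v \<in> S" "norm v = 1" "f v = e *\<^sub>R v"
proof -
  let ?K = "S \<inter> sphere 0 1"
  obtain w where w: "w \<in> S" "w \<noteq> 0"
    using S subspace_0 by blast
  have "w /\<^sub>R norm w \<in> ?K"
    using w S(1) by (simp add: subspace_scale)
  then have ne: "?K \<noteq> {}" by blast
  have "compact ?K"
    using closed_subspace[OF S(1)] compact_sphere by (metis closed_Int_compact)
  moreover have "continuous_on ?K (\<lambda>x. x \<bullet> f x)"
    using lin by (intro continuous_intros linear_continuous_on) (simp add: linear_conv_bounded_linear)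
  ultimately obtain v where v: "v \<in> ?K" and max: "\<And>x. x \<in> ?K \<Longrightarrow> x \<bullet> f x \<le> v \<bullet> f v"
    using continuous_attains_sup[OF _ ne] by blast
  define e where "e = v \<bullet> f v"
  have vS: "v \<in> S" and nv: "norm v = 1" and vv: "v \<bullet> v = 1"
    using v by (auto simp: dot_square_norm)
  \<comment> \<open>\<open>q \<ge> 0\<close> on \<open>S\<close> with \<open>q v = 0\<close>, so the derivative of \<open>q\<close> at \<open>v\<close> in the direction \<open>u\<close> below vanishes.\<close>
  define q where "q x = e * (x \<bullet> x) - x \<bullet> f x" for x
  have q_nonneg: "0 \<le> q x" if "x \<in> S" for x
  proof (cases "x = 0")
    case False
    then have "(x /\<^sub>R norm x) \<bullet> f (x /\<^sub>R norm x) \<le> e"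
      unfolding e_def using that S(1) by (intro max) (simp add: subspace_scale)
    then have "(x \<bullet> f x) / (norm x)\<^sup>2 \<le> e"
      by (simp add: linear_scale[OF lin] power2_eq_square divide_inverse ac_simps)
    then show ?thesis
      using False by (simp add: q_def divide_le_eq dot_square_norm)
  qed (simp add: q_def linear_0[OF lin])
  \<comment> \<open>\<open>u\<close> is half the gradient of \<open>q\<close> at \<open>v\<close>:
    if it were nonzero, a small step against it would make \<open>q\<close> negative inside
    \<open>S\<close>.\<close>
  define u where "u = e *\<^sub>R v - f v"
  have uS: "u \<in> S"
    using S vS by (auto simp: u_def subspace_scale subspace_diff)
  have expand: "q (v + t *\<^sub>R u) = 2 * t * (u \<bullet> u) + t\<^sup>2 * q u" for t
  proof -
    have "u \<bullet> u = e * (v \<bullet> u) - v \<bullet> f u"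
      by (simp add: u_def inner_diff_left sym)
    moreover have "v \<bullet> f u = u \<bullet> f v" by (metis sym inner_commute)
    ultimately have *: "u \<bullet> f v = e * (v \<bullet> u) - u \<bullet> u" "v \<bullet> f u = e * (v \<bullet> u) - u \<bullet> u"
      by simp_all
    show ?thesis
      unfolding q_def linear_add[OF lin] linear_scale[OF lin]
      by (simp add: vv e_def[symmetric] * inner_add_left inner_add_right inner_commute[of u v])
         (simp add: algebra_simps power2_eq_square)
  qed
  have "u \<bullet> u = 0"
  proof (rule ccontr)
    assume "u \<bullet> u \<noteq> 0"
    then have pos: "0 < u \<bullet> u" by (simp add: less_le)
    have qu: "0 \<le> q u" by (rule q_nonneg[OF uS])
    \<comment> \<open>Short enough that the quadratic term \<open>t\<^sup>2 * q u\<close> cannot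
      offset the linear one; the \<open>+ 1\<close> keeps the denominator positive when
      \<open>q u = 0\<close>.\<close>
    define t where "t = - (u \<bullet> u) / (q u + 1)"
    have t: "t < 0" using pos qu by (simp add: t_def divide_less_0_iff)
    have "0 \<le> q (v + t *\<^sub>R u)"
      by (intro q_nonneg subspace_add subspace_scale S vS uS)
    then have "0 \<le> t * (2 * (u \<bullet> u) + t * q u)"
      unfolding expand by (simp add: algebra_simps power2_eq_square)
    then have "2 * (u \<bullet> u) + t * q u \<le> 0"
      using t by (simp add: zero_le_mult_iff)
    moreover have "- t * q u \<le> u \<bullet> u"
      using pos qu by (simp add: t_def field_simps)
    ultimately show False using pos by simp
  qed
  then have "f v = e *\<^sub>R v" by (simp add: u_def)
  with vS nv that show thesis by blast
qed

text \<open>Induction on the dimension: split off a unit eigenvector \<open>v\<close>;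
  self-adjointness makes its orthogonal complement within \<open>S\<close> invariant, and that
  complement has smaller dimension.\<close>

lemma selfadjoint_orthonormal_eigenvectors:
  fixes f :: "'a::euclidean_space \<Rightarrow> 'a"
  assumes lin: "linear f" and sym: "\<And>x y. f x \<bullet> y = x \<bullet> f y"
  shows "subspace S \<Longrightarrow> f ` S \<subseteq> S \<Longrightarrow>
    \<exists>B. finite B \<and> pairwise orthogonal B \<and> span B = S \<and> (\<forall>b\<in>B. norm b = 1 \<and> (\<exists>e. f b = e *\<^sub>R b))"
proof (induction "dim S" arbitrary: S rule: less_induct)
  case less
  show ?case
  proof (cases "S = {0}")
    case True
    then show ?thesis by (intro exI[of _ "{}"]) auto
  next
    case False
    obtain v e where v: "v \<in> S" "norm v = 1" "f v = e *\<^sub>R v"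
      using selfadjoint_eigenvector_in_subspace[OF lin sym less.prems False] by blast
    define T where "T = {x \<in> S. x \<bullet> v = 0}"
    have T: "subspace T"
      using less.prems(1) by (auto simp: T_def subspace_def inner_add_left)
    have fT: "f ` T \<subseteq> T"
      using less.prems(2) by (auto simp: T_def sym v)
    have vv: "v \<bullet> v = 1" using v by (simp add: dot_square_norm)
    have "v \<notin> T" using vv by (simp add: T_def)
    then have "T \<subset> S" using v(1) unfolding T_def by blast
    then have "span T \<subset> span S"
      using T less.prems(1) by (metis span_eq_iff)
    then have "dim T < dim S"
      by (rule dim_psubset)
    from less.hyps[OF this T fT] obtain B where B: "finite B" "pairwise orthogonal B" "span B = T"
      "\<forall>b\<in>B. norm b = 1 \<and> (\<exists>e. f b = e *\<^sub>R b)" by blast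
    have BT: "B \<subseteq> T" using B(3) span_superset by blast
    have "span (insert v B) = S"
    proof
      show "span (insert v B) \<subseteq> S"
        using BT v less.prems(1) by (intro span_minimal) (auto simp: T_def)
      show "S \<subseteq> span (insert v B)"
      proof
        fix x assume "x \<in> S"
        then have "x - (x \<bullet> v) *\<^sub>R v \<in> span B"
          using v vv less.prems(1) B(3)
          by (auto simp: T_def subspace_diff subspace_scale inner_diff_left)
        then show "x \<in> span (insert v B)"
          unfolding span_insert by blast
      qed
    qed
    moreover have "pairwise orthogonal (insert v B)"
      using B(2) BT by (auto simp: pairwise_insert T_def orthogonal_def inner_commute)
    ultimately show ?thesis
      using B v by (intro exI[of _ "insert v B"]) auto
  qed
qed

section \<open>Orthogonal diagonalization in matrix form\<close>

definition diag_matrix :: "('n \<Rightarrow> real) \<Rightarrow> real^'n^'n" where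
  "diag_matrix a = (\<chi> i j. if i = j then a i else 0)"

lemma diag_matrix_mult_vector [simp]: "(diag_matrix a *v x) $ i = a i * x $ i"
  by (simp add: diag_matrix_def matrix_vector_mult_def if_distrib[of "\<lambda>c. c * _"] cong: if_cong)

lemma trace_diag_matrix [simp]: "trace (diag_matrix a) = sum a UNIV"
  by (simp add: trace_def diag_matrix_def)

lemma diag_matrix_mult [simp]: "diag_matrix a ** diag_matrix b = diag_matrix (\<lambda>i. a i * b i)"
  by (simp add: diag_matrix_def matrix_matrix_mult_def vec_eq_iff if_distrib[of "\<lambda>c. c * _"] cong: if_cong)

lemma symmetric_matrix_diagonalizable:
  fixes A :: "real^'n^'n"
  assumes "transpose A = A"
  obtains U a where "orthogonal_matrix U" "A = U ** diag_matrix a ** transpose U"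
proof -
  have sym: "(A *v x) \<bullet> y = x \<bullet> (A *v y)" for x y
    by (metis assms dot_lmul_matrix transpose_matrix_vector)
  obtain B where B: "finite B" "pairwise orthogonal B" "span B = UNIV"
      "\<forall>b\<in>B. norm b = 1 \<and> (\<exists>e. A *v b = e *\<^sub>R b)"
    using selfadjoint_orthonormal_eigenvectors[OF matrix_vector_mul_linear sym, of UNIV] by auto
  have "independent B"
    using B by (intro pairwise_orthogonal_independent) auto
  then have "card B = CARD('n)"
    using B(3) by (metis dim_UNIV dim_span_eq_card_independent DIM_cart DIM_real mult.right_neutral)
  \<comment> \<open>The eigenbasis has as many elements as the index type, so it can be enumerated
    by coordinates and used as the columns of \<open>U\<close>.\<close>
  then obtain c where c: "bij_betw c (UNIV::'n set) B"
    using B(1) by (metis finite_same_card_bij finite_code)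
  then have cB: "c i \<in> B" for i by (auto simp: bij_betw_def)
  have "c i \<noteq> c j" if "i \<noteq> j" for i j
    using c that by (auto simp: bij_betw_def inj_def)
  then have cc: "c i \<bullet> c j = (if i = j then 1 else 0)" for i j
    using B(2,4) cB[of i] cB[of j]
    by (cases "i = j") (auto simp: pairwise_def orthogonal_def dot_square_norm)
  have "\<forall>i. \<exists>e. A *v c i = e *\<^sub>R c i"
    using B(4) cB by blast
  then obtain a where a: "A *v c i = a i *\<^sub>R c i" for i
    unfolding choice_iff by blast
  define U where "U = (\<chi> k i. c i $ k)"
  have UU: "transpose U ** U = mat 1"
    using cc by (simp add: U_def vec_eq_iff matrix_matrix_mult_def transpose_def mat_def inner_vec_def)
  then have U: "orthogonal_matrix U" by (simp add: orthogonal_matrix)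
  have "A ** U = U ** diag_matrix a"
  proof -
    have "(A ** U) $ k $ i = (A *v c i) $ k" for k i
      by (simp add: U_def matrix_matrix_mult_def matrix_vector_mult_def)
    moreover have "(U ** diag_matrix a) $ k $ i = a i * c i $ k" for k i
      by (simp add: U_def matrix_matrix_mult_def diag_matrix_def if_distrib cong: if_cong)
    ultimately show ?thesis by (simp add: vec_eq_iff a)
  qed
  moreover have "A = A ** U ** transpose U"
    using U by (simp add: orthogonal_matrix_def flip: matrix_mul_assoc)
  ultimately show thesis using U that by metis
qed

lemma trace_conjugate_orthogonal:
  fixes U :: "real^'n^'n"
  assumes "orthogonal_matrix U"
  shows "trace (U ** M ** transpose U) = trace M"
proof -
  have "trace (U ** M ** transpose U) = trace (transpose U ** (U ** M))"
    by (rule trace_mul_sym)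
  also have "\<dots> = trace M"
    using assms by (simp add: matrix_mul_assoc orthogonal_matrix_def)
  finally show ?thesis .
qed

lemma norm_matrix_trace:
  fixes A :: "real^'p^'n"
  shows "(norm A)\<^sup>2 = trace (transpose A ** A)"
  unfolding norm_matrix_frobenius trace_def matrix_matrix_mult_def transpose_def
  by (subst sum.swap) (simp add: power2_eq_square)

lemma conjugate_orthogonal_mult:
  fixes U :: "real^'n^'n"
  assumes "orthogonal_matrix U"
  shows "(U ** M ** transpose U) ** (U ** N ** transpose U) = U ** (M ** N) ** transpose U"
proof -
  have "(U ** M ** transpose U) ** (U ** N ** transpose U) = U ** M ** (transpose U ** U) ** N ** transpose U"
    by (simp add: matrix_mul_assoc)
  also have "transpose U ** U = mat 1"
    using assms by (simp add: orthogonal_matrix_def)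
  finally show ?thesis by (simp add: matrix_mul_assoc)
qed

lemma inner_conjugate_matrix:
  fixes U :: "real^'n^'n"
  shows "x \<bullet> ((U ** M ** transpose U) *v x) = (transpose U *v x) \<bullet> (M *v (transpose U *v x))"
  by (simp add: dot_lmul_matrix transpose_matrix_vector flip: matrix_vector_mul_assoc)

lemma inner_diag_matrix: "x \<bullet> (diag_matrix a *v x) = (\<Sum>i\<in>UNIV. a i * (x $ i)\<^sup>2)"
  by (simp add: inner_vec_def power2_eq_square ac_simps)

text \<open>The eigenvector is the \<open>i\<close>-th column of \<open>U\<close>. This ties the
  diagonal entries to \<open>eigenvalues\<close>, from which the spectral constants in
  \<open>Q_bound\<close> are defined.\<close>

lemma eigenvalue_conjugate_diag:
  fixes U :: "real^'n^'n"
  assumes "orthogonal_matrix U"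
  shows "a i \<in> eigenvalues (U ** diag_matrix a ** transpose U)"
proof -
  let ?v = "U *v axis i 1"
  have *: "transpose U *v ?v = axis i 1"
    using assms by (simp add: orthogonal_matrix_def matrix_vector_mul_assoc)
  have "diag_matrix a *v axis i 1 = a i *\<^sub>R axis i 1"
    by (simp add: vec_eq_iff axis_def)
  then have "(U ** diag_matrix a ** transpose U) *v ?v = a i *\<^sub>R ?v"
    by (simp only: matrix_vector_mul_assoc[symmetric] *) (simp add: matrix_vector_mult_scaleR)
  moreover have "?v \<noteq> 0" using * by (metis axis_eq_0_iff matrix_vector_mult_0_right zero_neq_one)
  ultimately show ?thesis unfolding eigenvalues_def by blast
qed

section \<open>Spectral bounds for quadratic forms\<close>

lemma largest_pos_eigenvalue_nonneg: "0 \<le> largest_pos_eigenvalue A"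
proof (cases "\<exists>e\<in>eigenvalues A. 0 < e")
  case True
  then have "Max {e \<in> eigenvalues A. e > 0} \<in> {e \<in> eigenvalues A. e > 0}"
    by (intro Max_in) (auto simp: finite_eigenvalues)
  then show ?thesis using True by (simp add: largest_pos_eigenvalue_def)
qed (simp add: largest_pos_eigenvalue_def)

text \<open>A nonpositive eigenvalue is covered by the nonnegativity of the right-hand side, whether
  that is a maximum or the default 0.\<close>

lemma eigenvalue_le_largest_pos_eigenvalue:
  assumes "e \<in> eigenvalues A"
  shows "e \<le> largest_pos_eigenvalue A"
proof (cases "0 < e")
  case True
  then show ?thesis
    using assms by (auto simp: largest_pos_eigenvalue_def finite_eigenvalues intro!: Max_ge)
next
  case False
  then show ?thesis using largest_pos_eigenvalue_nonneg[of A] by linarith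
qed

text \<open>For symmetric \<open>B\<close> the moduli of the eigenvalues are singular values, since
  \<open>transpose B ** B\<close> is diagonalized by the same \<open>U\<close> with squared entries.
  In eigencoordinates the quadratic form is then a sum of squares with weights at most the largest
  singular value.\<close>

lemma
  fixes B :: "real^'n^'n"
  assumes "transpose B = B"
  shows largest_singular_value_nonneg: "0 \<le> largest_singular_value B"
    and inner_le_largest_singular_value: "x \<bullet> (B *v x) \<le> largest_singular_value B * (norm x)\<^sup>2"
proof -
  obtain U b where U: "orthogonal_matrix U" and B: "B = U ** diag_matrix b ** transpose U"
    using symmetric_matrix_diagonalizable[OF assms] .
  have "transpose B ** B = U ** diag_matrix (\<lambda>i. b i * b i) ** transpose U"
    unfolding assms by (simp add: B conjugate_orthogonal_mult[OF U])
  then have "sqrt (b i * b i) \<in> singular_values B" for i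
    unfolding singular_values_def using eigenvalue_conjugate_diag[OF U] by (metis imageI)
  then have "\<bar>b i\<bar> \<le> largest_singular_value B" for i
    unfolding largest_singular_value_def
    by (intro Max_ge) (auto simp: singular_values_def finite_eigenvalues)
  then have le: "0 \<le> largest_singular_value B" "b i \<le> largest_singular_value B" for i
    by (meson abs_ge_zero order_trans abs_ge_self)+
  then show "0 \<le> largest_singular_value B" by simp
  let ?w = "transpose U *v x"
  have "x \<bullet> (B *v x) = (\<Sum>i\<in>UNIV. b i * (?w $ i)\<^sup>2)"
    by (simp only: B inner_conjugate_matrix inner_diag_matrix)
  also have "\<dots> \<le> (\<Sum>i\<in>UNIV. largest_singular_value B * (?w $ i)\<^sup>2)"
    by (intro sum_mono mult_right_mono le) auto
  also have "\<dots> = largest_singular_value B * (norm ?w)\<^sup>2"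
    by (simp add: norm_vec_def L2_set_def sum_nonneg sum_distrib_left)
  also have "norm ?w = norm x"
    using U by (metis orthogonal_matrix_transpose orthogonal_transformation_matrix
        orthogonal_transformation_norm matrix_vector_mul_linear matrix_of_matrix_vector_mul)
  finally show "x \<bullet> (B *v x) \<le> largest_singular_value B * (norm x)\<^sup>2" .
qed

section \<open>Standard normal vectors\<close>

lemma nn_integral_lborel_translation:
  fixes c :: "'a::euclidean_space"
  assumes "g \<in> borel_measurable borel"
  shows "(\<integral>\<^sup>+x. g (c + x) \<partial>lborel) = (\<integral>\<^sup>+x. g x \<partial>lborel)"
  using nn_integral_distr[of "(+) c" lborel borel g] assms by (simp add: lborel_distr_plus)

lemma nn_integral_lborel_reflection:
  fixes c :: "'a::euclidean_space"
  assumes [measurable]: "g \<in> borel_measurable borel"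
  shows "(\<integral>\<^sup>+x. g (c - x) \<partial>lborel) = (\<integral>\<^sup>+x. g x \<partial>lborel)"
proof -
  have "lborel = density (distr lborel borel ((-) c)) (\<lambda>_. 1)"
    using lborel_affine[of "-1" c] by simp
  then have "(\<integral>\<^sup>+x. g x \<partial>lborel) = (\<integral>\<^sup>+x. g x \<partial>density (distr lborel borel ((-) c)) (\<lambda>_. 1))"
    by simp
  also have "\<dots> = (\<integral>\<^sup>+x. g (c - x) \<partial>lborel)"
    by (simp add: nn_integral_density nn_integral_distr)
  finally show ?thesis by simp
qed

text \<open>
  As in the uniqueness proof for Haar measure, \<open>\<integral>\<integral> 1\<^sub>E (f x) 1\<^sub>B (f x + y) dx dy\<close> is evaluated in both
  orders, for a set \<open>B\<close> that \<open>f\<close> preserves.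
\<close>
lemma lborel_distr_orthogonal:
  fixes f :: "'a::euclidean_space \<Rightarrow> 'a"
  assumes f: "orthogonal_transformation f"
  shows "distr lborel borel f = lborel"
proof (rule measure_eqI)
  fix E assume "E \<in> sets (distr lborel borel f)"
  then have E [measurable]: "E \<in> sets borel" by simp
  have lin: "linear f" using f by (simp add: orthogonal_transformation)
  have f_borel [measurable]: "f \<in> borel \<rightarrow>\<^sub>M borel"
    by (intro borel_measurable_continuous_onI linear_continuous_on) (simp add: lin flip: linear_conv_bounded_linear)
  obtain g where g: "\<And>x. f (g x) = x"
    using orthogonal_transformation_surj[OF f] by (metis surjD)
  \<comment> \<open>The unit ball is preserved because \<open>f\<close> is an isometry, and its
    measure is positive and finite, so it can be cancelled at the end.\<close>
  define B where "B = ball (0::'a) 1"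
  have B [measurable]: "B \<in> sets borel" by (simp add: B_def)
  have fB: "f x \<in> B \<longleftrightarrow> x \<in> B" for x
    using orthogonal_transformation_norm[OF f] by (simp add: B_def)
  let ?i = "\<lambda>S. indicator S :: 'a \<Rightarrow> ennreal"
  have "(\<integral>\<^sup>+x. ?i E (f x) \<partial>lborel) * emeasure lborel B = (\<integral>\<^sup>+x. (\<integral>\<^sup>+y. ?i E (f x) * ?i B (f x + y) \<partial>lborel) \<partial>lborel)"
    by (simp add: nn_integral_cmult nn_integral_multc nn_integral_lborel_translation)
  also have "\<dots> = (\<integral>\<^sup>+y. (\<integral>\<^sup>+x. ?i E (f x) * ?i B (f x + y) \<partial>lborel) \<partial>lborel)"
    by (intro lborel_pair.Fubini') measurable
  also have "\<dots> = (\<integral>\<^sup>+y. (\<integral>\<^sup>+x. ?i E (f x - y) * ?i B (f x) \<partial>lborel) \<partial>lborel)"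
  proof (rule nn_integral_cong)
    fix y :: 'a
    \<comment> \<open>Translating \<open>x\<close> by a preimage of \<open>- y\<close> moves
      \<open>y\<close> from the argument of one indicator to that of the other.\<close>
    have *: "f (g (- y) + x) = f x - y" for x
      using g by (simp add: linear_add[OF lin])
    show "(\<integral>\<^sup>+x. ?i E (f x) * ?i B (f x + y) \<partial>lborel) = (\<integral>\<^sup>+x. ?i E (f x - y) * ?i B (f x) \<partial>lborel)"
      using nn_integral_lborel_translation[of "\<lambda>x. ?i E (f x) * ?i B (f x + y)" "g (- y)"]
      by (simp add: *)
  qed
  also have "\<dots> = (\<integral>\<^sup>+x. (\<integral>\<^sup>+y. ?i E (f x - y) * ?i B (f x) \<partial>lborel) \<partial>lborel)"
    by (intro lborel_pair.Fubini'[symmetric]) measurable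
  also have "\<dots> = (\<integral>\<^sup>+x. emeasure lborel E * ?i B (f x) \<partial>lborel)"
    by (simp add: nn_integral_multc nn_integral_lborel_reflection)
  also have "\<dots> = emeasure lborel E * emeasure lborel B"
    by (simp add: nn_integral_cmult indicator_def fB flip: nn_integral_indicator)
  finally have *: "(\<integral>\<^sup>+x. ?i E (f x) \<partial>lborel) * emeasure lborel B = emeasure lborel E * emeasure lborel B" .
  have "emeasure lborel B \<noteq> \<infinity>"
    using emeasure_lborel_ball_finite[of "0::'a" 1] by (simp add: B_def less_top)
  moreover have "emeasure lborel B \<noteq> 0"
    using open_not_negligible[of B] B by (auto simp: B_def negligible_iff_null_sets null_sets_def)
  ultimately have "(\<integral>\<^sup>+x. ?i E (f x) \<partial>lborel) = emeasure lborel E"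
    using * by (simp add: mult.commute[of _ "emeasure lborel B"] ennreal_mult_cancel_left)
  then show "emeasure (distr lborel borel f) E = emeasure lborel E"
    by (simp add: nn_integral_distr flip: nn_integral_indicator)
qed simp

section \<open>Coordinates, product structure and the Gaussian density\<close>

lemma borel_measurable_vec_lambda:
  assumes "\<And>i. (\<lambda>x. f x i) \<in> borel_measurable M"
  shows "(\<lambda>x. (\<chi> i. f x i) :: real^'n) \<in> borel_measurable M"
  using assms by (subst borel_measurable_euclidean_space) (auto simp: Basis_vec_def inner_axis)

lemma borel_measurable_vec_nth [measurable]: "(\<lambda>x::real^'n. x $ i) \<in> borel_measurable borel"
  by (intro borel_measurable_continuous_onI continuous_intros)

text \<open>Lebesgue measure is determined by its values on boxes, and boxes are products of
  intervals. This makes the factorization of integrals over product measures available for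
  vectors.\<close>

lemma lborel_vec_eq_distr_PiM:
  "(lborel :: (real^'n) measure) = distr (Pi\<^sub>M UNIV (\<lambda>_. lborel)) borel (\<lambda>w. \<chi> i. w i)"
proof (rule lborel_eqI)
  interpret product_sigma_finite "\<lambda>_::'n. lborel :: real measure" by standard
  have [measurable]: "(\<lambda>w. (\<chi> i. w i) :: real^'n) \<in> borel_measurable (Pi\<^sub>M UNIV (\<lambda>_. lborel))"
    by (intro borel_measurable_vec_lambda) simp
  fix l u :: "real^'n" assume lu: "\<And>b. b \<in> Basis \<Longrightarrow> l \<bullet> b \<le> u \<bullet> b"
  have le: "l $ i \<le> u $ i" for i
    using lu[of "axis i 1"] by (simp add: inner_axis)
  have "(\<lambda>w. \<chi> i. w i) -` box l u \<inter> space (Pi\<^sub>M UNIV (\<lambda>_. lborel)) = (\<Pi>\<^sub>E i\<in>UNIV. {l $ i<..<u $ i})"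
    by (auto simp: space_PiM mem_box_cart PiE_UNIV_domain Pi_iff)
  then have "emeasure (distr (Pi\<^sub>M UNIV (\<lambda>_. lborel)) borel (\<lambda>w. \<chi> i. w i)) (box l u) = (\<Prod>i\<in>UNIV. ennreal (u $ i - l $ i))"
    by (simp add: emeasure_distr emeasure_PiM le)
  also have "\<dots> = ennreal (\<Prod>i\<in>UNIV. u $ i - l $ i)"
    by (intro prod_ennreal) (simp add: le)
  also have "(\<Prod>i\<in>UNIV. u $ i - l $ i) = (\<Prod>b\<in>Basis. (u - l) \<bullet> b)"
  proof -
    have inj: "inj (\<lambda>i. axis i (1::real) :: real^'n)"
      by (auto simp: inj_def axis_eq_axis)
    have "(\<Prod>b\<in>Basis. (u - l) \<bullet> b) = (\<Prod>b\<in>range (\<lambda>i. axis i 1). (u - l) \<bullet> b)"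
      by (intro prod.cong) (auto simp: Basis_vec_def)
    also have "\<dots> = (\<Prod>i\<in>UNIV. u $ i - l $ i)"
      by (subst prod.reindex[OF inj]) (simp add: inner_axis)
    finally show ?thesis ..
  qed
  finally show "emeasure (distr (Pi\<^sub>M UNIV (\<lambda>_. lborel)) borel (\<lambda>w. (\<chi> i. w i))) (box l u) = ennreal (\<Prod>b\<in>Basis. (u - l) \<bullet> b)" .
qed simp

lemma nn_integral_lborel_vec_prod:
  fixes f :: "'n::finite \<Rightarrow> real \<Rightarrow> ennreal"
  assumes [measurable]: "\<And>i. f i \<in> borel_measurable borel"
  shows "(\<integral>\<^sup>+x. (\<Prod>i\<in>UNIV. f i ((x::real^'n) $ i)) \<partial>lborel) = (\<Prod>i\<in>UNIV. \<integral>\<^sup>+x. f i x \<partial>lborel)"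
proof -
  interpret product_sigma_finite "\<lambda>_::'n. lborel :: real measure" by standard
  have [measurable]: "(\<lambda>w. (\<chi> i. w i) :: real^'n) \<in> borel_measurable (Pi\<^sub>M UNIV (\<lambda>_. lborel))"
    by (intro borel_measurable_vec_lambda) simp
  show ?thesis
    by (subst lborel_vec_eq_distr_PiM) (simp add: nn_integral_distr product_nn_integral_prod)
qed

text \<open>Completing the square: with \<open>d = 1 - 2 * \<alpha>\<close>, positive by assumption,
  the integrand is a constant times the normal density of mean \<open>\<gamma> / d\<close> and
  variance \<open>1 / d\<close>.\<close>

lemma nn_integral_exp_quadratic_std_normal:
  assumes "2 * \<alpha> < 1"
  shows "(\<integral>\<^sup>+x. ennreal (std_normal_density x) * ennreal (exp (\<alpha> * x\<^sup>2 + \<gamma> * x)) \<partial>lborel)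
    = ennreal (exp (\<gamma>\<^sup>2 / (2 * (1 - 2 * \<alpha>))) / sqrt (1 - 2 * \<alpha>))"
proof -
  define d where "d = 1 - 2 * \<alpha>"
  have d: "0 < d" using assms by (simp add: d_def)
  let ?C = "exp (\<gamma>\<^sup>2 / (2 * d)) / sqrt d"
  have "std_normal_density x * exp (\<alpha> * x\<^sup>2 + \<gamma> * x) = ?C * normal_density (\<gamma> / d) (1 / sqrt d) x" for x
  proof -
    have "- (x\<^sup>2) / 2 + (\<alpha> * x\<^sup>2 + \<gamma> * x) = \<gamma>\<^sup>2 / (2 * d) + - ((x - \<gamma> / d)\<^sup>2 * d / 2)"
      using d by (simp add: field_simps power2_eq_square) (simp add: d_def algebra_simps)
    then have "exp (- (x\<^sup>2) / 2) * exp (\<alpha> * x\<^sup>2 + \<gamma> * x) = exp (\<gamma>\<^sup>2 / (2 * d)) * exp (- ((x - \<gamma> / d)\<^sup>2 * d / 2))"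
      by (simp flip: exp_add)
    then show ?thesis
      using d by (simp add: normal_density_def power_divide real_sqrt_divide real_sqrt_mult)
  qed
  then have "(\<integral>\<^sup>+x. ennreal (std_normal_density x) * ennreal (exp (\<alpha> * x\<^sup>2 + \<gamma> * x)) \<partial>lborel)
      = (\<integral>\<^sup>+x. ennreal ?C * ennreal (normal_density (\<gamma> / d) (1 / sqrt d) x) \<partial>lborel)"
    using d by (simp flip: ennreal_mult')
  also have "\<dots> = ennreal ?C"
    using d by (simp add: nn_integral_cmult nn_integral_eq_integral)
  finally show ?thesis by (simp add: d_def)
qed

text \<open>The joint density depends on its argument only through the Euclidean norm.\<close>

lemma prod_std_normal_density_orthogonal:
  fixes f :: "real^'n \<Rightarrow> real^'n"
  assumes "orthogonal_transformation f"
  shows "(\<Prod>i\<in>UNIV. std_normal_density (f x $ i)) = (\<Prod>i\<in>UNIV. std_normal_density (x $ i))"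
proof -
  have "(\<Prod>i\<in>UNIV. std_normal_density (v $ i)) = (1 / sqrt (2 * pi)) ^ CARD('n) * exp (- (norm v)\<^sup>2 / 2)" for v :: "real^'n"
    unfolding std_normal_density_def prod.distrib
    by (simp add: norm_vec_def L2_set_def sum_nonneg sum_divide_distrib flip: exp_sum sum_negf)
  then show ?thesis
    using orthogonal_transformation_norm[OF assms] by simp
qed

locale std_normal_vector = prob_space +
  fixes z :: "'a \<Rightarrow> real^'n"
  assumes indep_components: "indep_vars (\<lambda>_. borel) (\<lambda>i \<omega>. z \<omega> $ i) UNIV"
    and distributed_components: "distributed M lborel (\<lambda>\<omega>. z \<omega> $ i) std_normal_density"
begin

lemma component_measurable [measurable]: "(\<lambda>\<omega>. z \<omega> $ i) \<in> borel_measurable M"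
  using distributed_measurable[OF distributed_components[of i]] by simp

lemma vector_measurable [measurable]: "z \<in> borel_measurable M"
  using borel_measurable_vec_lambda[of "\<lambda>\<omega> i. z \<omega> $ i", OF component_measurable] by simp

lemma nn_integral_prod_components:
  assumes [measurable]: "\<And>i. f i \<in> borel_measurable borel"
  shows "(\<integral>\<^sup>+\<omega>. (\<Prod>i\<in>UNIV. f i (z \<omega> $ i)) \<partial>M)
    = (\<Prod>i\<in>UNIV. \<integral>\<^sup>+x. ennreal (std_normal_density x) * f i x \<partial>lborel)"
proof -
  have "indep_vars (\<lambda>_. borel) (\<lambda>i \<omega>. f i (z \<omega> $ i)) UNIV"
    by (rule indep_vars_compose2[OF indep_components]) simp
  then have "(\<integral>\<^sup>+\<omega>. (\<Prod>i\<in>UNIV. f i (z \<omega> $ i)) \<partial>M) = (\<Prod>i\<in>UNIV. \<integral>\<^sup>+\<omega>. f i (z \<omega> $ i) \<partial>M)"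
    by (intro indep_vars_nn_integral) auto
  also have "\<dots> = (\<Prod>i\<in>UNIV. \<integral>\<^sup>+x. ennreal (std_normal_density x) * f i x \<partial>lborel)"
    by (intro prod.cong distributed_nn_integral[OF distributed_components, symmetric]) auto
  finally show ?thesis .
qed

text \<open>On an open box both measures factor over the coordinates, by independence on the left
  and by Tonelli on the right; boxes are an intersection-stable generator of the Borel sets.\<close>

lemma distr_eq_density:
  "distr M borel z = density lborel (\<lambda>x. \<Prod>i\<in>UNIV. ennreal (std_normal_density (x $ i)))" (is "_ = ?D")
proof (rule measure_eqI_generator_eq)
  let ?E = "range (\<lambda>(a, b). box a b::(real^'n) set)"
  show "Int_stable ?E"
    by (auto simp: Int_stable_def box_Int_box)
  show "?E \<subseteq> Pow UNIV" "sets (distr M borel z) = sigma_sets UNIV ?E" "sets ?D = sigma_sets UNIV ?E"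
    by (simp_all add: borel_eq_box)
  let ?A = "\<lambda>n::nat. box (- (real n *\<^sub>R One)) (real n *\<^sub>R One) :: (real^'n) set"
  show "range ?A \<subseteq> ?E" "(\<Union>i. ?A i) = UNIV"
    unfolding UN_box_eq_UNIV by auto
  interpret D: prob_space "distr M borel z"
    by (rule prob_space_distr) simp
  show "emeasure (distr M borel z) (?A i) \<noteq> \<infinity>" for i by simp
  show "emeasure (distr M borel z) X = emeasure ?D X" if "X \<in> ?E" for X
  proof -
    obtain l u where X: "X = box l u" using \<open>X \<in> ?E\<close> by auto
    have ind: "indicator X x = (\<Prod>i\<in>UNIV. indicator {l $ i<..<u $ i} (x $ i) :: ennreal)" for x :: "real^'n"
    proof (cases "x \<in> X")
      case False
      then have "\<exists>i\<in>UNIV. indicator {l $ i<..<u $ i} (x $ i) = (0 :: ennreal)"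
        by (auto simp: X mem_box_cart indicator_def)
      then have "(\<Prod>i\<in>UNIV. indicator {l $ i<..<u $ i} (x $ i) :: ennreal) = 0"
        by (intro prod_zero) auto
      then show ?thesis using False by simp
    qed (simp add: X mem_box_cart)
    have "emeasure (distr M borel z) X = (\<integral>\<^sup>+\<omega>. (\<Prod>i\<in>UNIV. indicator {l $ i<..<u $ i} (z \<omega> $ i)) \<partial>M)"
      by (simp add: X nn_integral_distr ind[unfolded X] flip: nn_integral_indicator)
    also have "\<dots> = (\<integral>\<^sup>+x. (\<Prod>i\<in>UNIV. ennreal (std_normal_density (x $ i)) * indicator {l $ i<..<u $ i} (x $ i)) \<partial>lborel)"
      by (subst nn_integral_prod_components, simp, subst nn_integral_lborel_vec_prod, simp_all)
    also have "\<dots> = emeasure ?D X"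
      by (simp add: emeasure_density X ind[unfolded X] prod.distrib)
    finally show ?thesis .
  qed
qed

text \<open>The Gaussian density and Lebesgue measure are both invariant under orthogonal maps,
  hence so is the law of \<open>z\<close>.\<close>

lemma nn_integral_orthogonal:
  assumes "orthogonal_matrix U" and F [measurable]: "F \<in> borel_measurable borel"
  shows "(\<integral>\<^sup>+\<omega>. F (U *v z \<omega>) \<partial>M) = (\<integral>\<^sup>+\<omega>. F (z \<omega>) \<partial>M)"
proof -
  let ?g = "\<lambda>x::real^'n. \<Prod>i\<in>UNIV. ennreal (std_normal_density (x $ i))"
  have U: "orthogonal_transformation ((*v) U)"
    using assms(1) by (simp add: orthogonal_transformation_matrix)
  have U_borel [measurable]: "(*v) U \<in> borel \<rightarrow>\<^sub>M borel"
    by (intro borel_measurable_continuous_onI continuous_intros)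
  have g: "?g (U *v x) = ?g x" for x
    using prod_std_normal_density_orthogonal[OF U, of x] by (simp add: prod_ennreal)
  have eq: "(\<integral>\<^sup>+\<omega>. G (z \<omega>) \<partial>M) = (\<integral>\<^sup>+x. ?g x * G x \<partial>lborel)" if [measurable]: "G \<in> borel_measurable borel" for G
  proof -
    have "(\<integral>\<^sup>+\<omega>. G (z \<omega>) \<partial>M) = (\<integral>\<^sup>+x. G x \<partial>distr M borel z)"
      by (simp add: nn_integral_distr)
    then show ?thesis by (simp add: distr_eq_density nn_integral_density)
  qed
  have "(\<integral>\<^sup>+\<omega>. F (U *v z \<omega>) \<partial>M) = (\<integral>\<^sup>+x. ?g (U *v x) * F (U *v x) \<partial>lborel)"
    using eq[of "\<lambda>x. F (U *v x)"] by (simp add: g)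
  also have "\<dots> = (\<integral>\<^sup>+x. ?g x * F x \<partial>distr lborel borel ((*v) U))"
    by (simp add: nn_integral_distr)
  also have "\<dots> = (\<integral>\<^sup>+\<omega>. F (z \<omega>) \<partial>M)"
    by (simp add: lborel_distr_orthogonal[OF U] eq)
  finally show ?thesis .
qed

end

section \<open>Tails of Gaussian quadratic forms\<close>

text \<open>The difference \<open>g\<close> of the two sides has a derivative with the sign of
  \<open>t\<close> for \<open>t < y\<close>, so it is smallest at 0, where it vanishes. Having
  \<open>y\<close> in place of \<open>x\<close> in the denominator gives one denominator for all
  eigenvalues, negative ones included.\<close>

lemma neg_ln_one_minus_le:
  fixes x y :: real
  assumes "x \<le> y" "0 \<le> y" "y < 1"
  shows "- ln (1 - x) \<le> x + x\<^sup>2 / (2 * (1 - y))"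
proof -
  define k where "k = 1 / (2 * (1 - y))"
  define g where "g x = x + k * x\<^sup>2 + ln (1 - x)" for x
  have deriv: "(g has_real_derivative t * (y - t) / ((1 - y) * (1 - t))) (at t)" if "t \<le> y" for t
  proof -
    have "1 + k * (2 * t) - 1 / (1 - t) = t * (y - t) / ((1 - y) * (1 - t))"
      using that assms by (simp add: k_def divide_simps) (simp add: algebra_simps)
    moreover have "(g has_real_derivative 1 + k * (2 * t) - 1 / (1 - t)) (at t)"
      unfolding g_def[abs_def] using that assms
      by (auto intro!: derivative_eq_intros)
    ultimately show ?thesis by simp
  qed
  have "g 0 \<le> g x"
  proof (cases "0 \<le> x")
    case True
    then show ?thesis
      using assms by (intro DERIV_nonneg_imp_nondecreasing[OF True]) (auto intro!: exI deriv divide_nonneg_nonneg mult_nonneg_nonneg)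
  next
    case False
    then show ?thesis
      using assms by (intro DERIV_nonpos_imp_nonincreasing[of x 0 g])
        (auto intro!: exI deriv divide_nonpos_nonneg mult_nonpos_nonneg)
  qed
  then show ?thesis by (simp add: g_def k_def)
qed

text \<open>The left side is the Laplace factor of one eigencoordinate, with \<open>a\<close> the
  eigenvalue and \<open>w\<close> the linear coefficient. The logarithmic inequality at
  \<open>2 * t * a\<close> replaces it by an exponential whose exponent has a denominator
  independent of \<open>a\<close>, so that exponents can be summed.\<close>

lemma gaussian_mgf_factor_le:
  fixes a c t w :: real
  assumes "0 \<le> t" "a \<le> c" "0 \<le> c" "2 * t * c < 1"
  shows "exp ((2 * t * w)\<^sup>2 / (2 * (1 - 2 * (t * a)))) / sqrt (1 - 2 * (t * a))
    \<le> exp (t * a + t\<^sup>2 * (a\<^sup>2 + 2 * w\<^sup>2) / (1 - 2 * t * c))"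
proof -
  define d where "d = 1 - 2 * t * c"
  have ta: "t * a \<le> t * c" "0 \<le> t * c" using assms by (auto intro: mult_left_mono)
  have d: "0 < d" "d \<le> 1 - 2 * (t * a)" using assms ta by (auto simp: d_def)
  have "- ln (1 - 2 * (t * a)) \<le> 2 * (t * a) + (2 * (t * a))\<^sup>2 / (2 * d)"
    using neg_ln_one_minus_le[of "2 * (t * a)" "2 * t * c"] ta assms by (simp add: d_def)
  also have "(2 * (t * a))\<^sup>2 / (2 * d) = 2 * (t\<^sup>2 * a\<^sup>2 / d)"
    using d by (simp add: field_simps power2_eq_square)
  finally have "- (ln (1 - 2 * (t * a)) / 2) \<le> t * a + t\<^sup>2 * a\<^sup>2 / d" by simp
  moreover have "(2 * t * w)\<^sup>2 / (2 * (1 - 2 * (t * a))) \<le> (2 * t * w)\<^sup>2 / (2 * d)"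
    using d by (intro frac_le) auto
  moreover have "(2 * t * w)\<^sup>2 / (2 * d) = t\<^sup>2 * (2 * w\<^sup>2) / d"
    by (simp add: power2_eq_square)
  ultimately have "(2 * t * w)\<^sup>2 / (2 * (1 - 2 * (t * a))) - ln (1 - 2 * (t * a)) / 2
      \<le> t * a + t\<^sup>2 * a\<^sup>2 / d + t\<^sup>2 * (2 * w\<^sup>2) / d" by linarith
  also have "\<dots> = t * a + t\<^sup>2 * (a\<^sup>2 + 2 * w\<^sup>2) / d"
    by (simp add: distrib_left add_divide_distrib)
  finally have "exp ((2 * t * w)\<^sup>2 / (2 * (1 - 2 * (t * a))) - ln (1 - 2 * (t * a)) / 2)
      \<le> exp (t * a + t\<^sup>2 * (a\<^sup>2 + 2 * w\<^sup>2) / d)" by simp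
  moreover have "exp (ln (1 - 2 * (t * a)) / 2) = sqrt (1 - 2 * (t * a))"
    using d by (simp flip: ln_sqrt)
  ultimately show ?thesis by (simp add: exp_diff d_def)
qed

text \<open>In the eigenbasis of \<open>A\<close> the exponent is a sum over coordinates, so the
  expectation factors. Trace, Frobenius norm and \<open>norm b\<close> are unchanged by the
  rotation, which turns the summed exponents back into invariants of \<open>A\<close> and
  \<open>b\<close>.\<close>

lemma (in std_normal_vector) nn_integral_exp_quadratic_le:
  assumes A: "transpose A = A" and t: "0 \<le> t" "2 * t * largest_pos_eigenvalue A < 1"
  shows "(\<integral>\<^sup>+\<omega>. ennreal (exp (t * (z \<omega> \<bullet> (A *v z \<omega>) + 2 * (b \<bullet> z \<omega>)))) \<partial>M)
    \<le> ennreal (exp (t * trace A + t\<^sup>2 * ((norm A)\<^sup>2 + 2 * (norm b)\<^sup>2) / (1 - 2 * t * largest_pos_eigenvalue A)))"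
proof -
  define c where "c = largest_pos_eigenvalue A"
  obtain U a where U: "orthogonal_matrix U" and AU: "A = U ** diag_matrix a ** transpose U"
    using symmetric_matrix_diagonalizable[OF A] .
  define w where "w = transpose U *v b"
  have a: "a i \<le> c" for i
    unfolding c_def AU by (intro eigenvalue_le_largest_pos_eigenvalue eigenvalue_conjugate_diag U)
  have c: "0 \<le> c" by (simp add: c_def largest_pos_eigenvalue_nonneg)
  have tc: "2 * t * c < 1" using t by (simp add: c_def)
  have ta: "2 * (t * a i) < 1" for i
    using mult_left_mono[OF a[of i] t(1)] tc by simp
  let ?F = "\<lambda>x. ennreal (exp (t * (x \<bullet> (A *v x) + 2 * (b \<bullet> x))))"
  have "?F (U *v x) = (\<Prod>i\<in>UNIV. ennreal (exp ((t * a i) * (x $ i)\<^sup>2 + (2 * t * w $ i) * x $ i)))" for x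
  proof -
    have "transpose U *v (U *v x) = x"
      using U by (simp add: matrix_vector_mul_assoc orthogonal_matrix_def)
    then have "(U *v x) \<bullet> (A *v (U *v x)) = (\<Sum>i\<in>UNIV. a i * (x $ i)\<^sup>2)"
      by (simp only: AU inner_conjugate_matrix inner_diag_matrix)
    moreover have "b \<bullet> (U *v x) = w \<bullet> x"
      by (simp add: w_def transpose_matrix_vector dot_lmul_matrix)
    ultimately have "t * ((U *v x) \<bullet> (A *v (U *v x)) + 2 * (b \<bullet> (U *v x)))
        = (\<Sum>i\<in>UNIV. (t * a i) * (x $ i)\<^sup>2 + (2 * t * w $ i) * x $ i)"
      by (simp add: inner_vec_def sum.distrib sum_distrib_left distrib_left ac_simps)
    then show ?thesis by (simp add: exp_sum prod_ennreal)
  qed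
  moreover have "?F \<in> borel_measurable borel"
    by (intro measurable_compose[OF _ measurable_ennreal] borel_measurable_continuous_onI continuous_intros)
  ultimately have "(\<integral>\<^sup>+\<omega>. ?F (z \<omega>) \<partial>M)
      = (\<integral>\<^sup>+\<omega>. (\<Prod>i\<in>UNIV. ennreal (exp ((t * a i) * (z \<omega> $ i)\<^sup>2 + (2 * t * w $ i) * z \<omega> $ i))) \<partial>M)"
    using nn_integral_orthogonal[OF U, of ?F] by simp
  also have "\<dots> = (\<Prod>i\<in>UNIV. \<integral>\<^sup>+x. ennreal (std_normal_density x) * ennreal (exp ((t * a i) * x\<^sup>2 + (2 * t * w $ i) * x)) \<partial>lborel)"
    by (rule nn_integral_prod_components) simp
  also have "\<dots> \<le> (\<Prod>i\<in>UNIV. ennreal (exp (t * a i + t\<^sup>2 * ((a i)\<^sup>2 + 2 * (w $ i)\<^sup>2) / (1 - 2 * t * c))))"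
    unfolding nn_integral_exp_quadratic_std_normal[OF ta]
  proof (subst (1 2) prod_ennreal)
    have "0 \<le> exp ((2 * t * w $ i)\<^sup>2 / (2 * (1 - 2 * (t * a i)))) / sqrt (1 - 2 * (t * a i))" for i
      using ta[of i] by (intro divide_nonneg_nonneg) auto
    then show "ennreal (\<Prod>i\<in>UNIV. exp ((2 * t * w $ i)\<^sup>2 / (2 * (1 - 2 * (t * a i)))) / sqrt (1 - 2 * (t * a i)))
        \<le> ennreal (\<Prod>i\<in>UNIV. exp (t * a i + t\<^sup>2 * ((a i)\<^sup>2 + 2 * (w $ i)\<^sup>2) / (1 - 2 * t * c)))"
      by (intro ennreal_leI prod_mono conjI gaussian_mgf_factor_le t a c tc)
  qed (use ta in \<open>auto simp: less_imp_le\<close>)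
  also have "\<dots> = ennreal (exp (t * sum a UNIV + t\<^sup>2 * ((\<Sum>i\<in>UNIV. (a i)\<^sup>2) + 2 * (\<Sum>i\<in>UNIV. (w $ i)\<^sup>2)) / (1 - 2 * t * c)))"
    by (simp add: prod_ennreal sum.distrib distrib_left add_divide_distrib flip: exp_sum sum_distrib_left sum_divide_distrib)
  also have "sum a UNIV = trace A"
    by (simp add: AU trace_conjugate_orthogonal[OF U])
  also have "(\<Sum>i\<in>UNIV. (a i)\<^sup>2) = (norm A)\<^sup>2"
    unfolding norm_matrix_trace A
    by (simp add: AU conjugate_orthogonal_mult[OF U] trace_conjugate_orthogonal[OF U] power2_eq_square)
  also have "(\<Sum>i\<in>UNIV. (w $ i)\<^sup>2) = (norm w)\<^sup>2"
    by (simp add: norm_vec_def L2_set_def sum_nonneg)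
  also have "norm w = norm b"
    unfolding w_def using U
    by (metis orthogonal_matrix_transpose orthogonal_transformation_matrix
        orthogonal_transformation_norm matrix_vector_mul_linear matrix_of_matrix_vector_mul)
  finally show ?thesis by (simp add: c_def)
qed

lemma (in std_normal_vector) quadratic_tail:
  assumes A: "transpose A = A" and "0 < x"
  shows "emeasure M {\<omega> \<in> space M. trace A + 2 * sqrt (((norm A)\<^sup>2 + 2 * (norm b)\<^sup>2) * x) + 2 * largest_pos_eigenvalue A * x
      < z \<omega> \<bullet> (A *v z \<omega>) + 2 * (b \<bullet> z \<omega>)} \<le> ennreal (exp (- x))"
proof -
  define c where "c = largest_pos_eigenvalue A"
  define v where "v = (norm A)\<^sup>2 + 2 * (norm b)\<^sup>2"
  define W where "W \<omega> = z \<omega> \<bullet> (A *v z \<omega>) + 2 * (b \<bullet> z \<omega>)" for \<omega>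
  have c: "0 \<le> c" by (simp add: c_def largest_pos_eigenvalue_nonneg)
  have "(\<lambda>y. y \<bullet> (A *v y) + 2 * (b \<bullet> y)) \<in> borel_measurable borel"
    by (intro borel_measurable_continuous_onI continuous_intros)
  from measurable_compose[OF vector_measurable this]
  have [measurable]: "W \<in> borel_measurable M" by (simp add: W_def[abs_def])
  define T where "T = trace A + 2 * sqrt (v * x) + 2 * c * x"
  show ?thesis
  proof (cases "v = 0")
    \<comment> \<open>Here \<open>A\<close> and \<open>b\<close> vanish, so the denominator
      \<open>D\<close> of the other case would be zero. The form is identically 0 and the strict
      inequality makes the event empty.\<close>
    case True
    then have "A = 0" "b = 0"
      by (simp_all add: v_def add_nonneg_eq_0_iff)
    then have "W \<omega> = 0" "trace A = 0" for \<omega>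
      by (simp_all add: W_def trace_def)
    then have "\<not> T < W \<omega>" for \<omega>
      using c \<open>0 < x\<close> by (simp add: T_def True not_less)
    then show ?thesis by (simp add: T_def v_def c_def W_def)
  next
    case False
    then have v: "0 < v" by (simp add: v_def less_le)
    \<comment> \<open>\<open>t = sqrt x / D\<close> minimizes the Chernoff exponent \<open>t\<^sup>2 v / (1 - 2 t c) - t (2 \<surd>(v x) + 2 c x)\<close>.\<close>
    define D where "D = sqrt v + 2 * c * sqrt x"
    define t where "t = sqrt x / D"
    have D: "0 < D" using v c \<open>0 < x\<close> by (simp add: D_def add_pos_nonneg)
    then have t: "0 < t" using \<open>0 < x\<close> by (simp add: t_def)
    have gap: "1 - 2 * t * c = sqrt v / D"
      using D by (simp add: t_def field_simps) (simp add: D_def)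
    have gap_pos: "0 < 1 - 2 * t * c"
      unfolding gap using v D by simp
    have exponent: "t\<^sup>2 * v / (1 - 2 * t * c) - t * (2 * sqrt (v * x) + 2 * c * x) = - x"
    proof -
      \<comment> \<open>Writing \<open>v\<close> and \<open>x\<close> as squares of their roots
        makes the identity a rational one.\<close>
      define a q where "a = sqrt v" and "q = sqrt x"
      have v_eq: "v = a * a" and x_eq: "x = q * q" and a: "0 < a"
        using v \<open>0 < x\<close> by (simp_all add: a_def q_def)
      have "t\<^sup>2 * (a * a) / (a / D) = q * q * a / D"
        using a D by (simp add: t_def power2_eq_square flip: q_def)
      moreover have "t * (2 * (a * q) + 2 * c * (q * q)) = q * q * (2 * a + 2 * c * q) / D"
        by (simp add: t_def algebra_simps add_divide_distrib flip: q_def)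
      ultimately have "t\<^sup>2 * (a * a) / (a / D) - t * (2 * (a * q) + 2 * c * (q * q))
          = q * q * (a - (2 * a + 2 * c * q)) / D"
        by (simp only: right_diff_distrib diff_divide_distrib)
      also have "a - (2 * a + 2 * c * q) = - D"
        by (simp add: D_def a_def q_def)
      finally show ?thesis
        unfolding gap real_sqrt_mult a_def[symmetric] q_def[symmetric]
        using D by (simp flip: v_eq x_eq)
    qed
    have "emeasure M {\<omega> \<in> space M. T < W \<omega>} = (\<integral>\<^sup>+\<omega>. indicator {\<omega> \<in> space M. T < W \<omega>} \<omega> \<partial>M)"
      by simp
    \<comment> \<open>Markov's inequality for \<open>exp (t * W \<omega>)\<close>, in pointwise
      form.\<close>
    also have "\<dots> \<le> (\<integral>\<^sup>+\<omega>. ennreal (exp (- (t * T))) * ennreal (exp (t * W \<omega>)) \<partial>M)"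
    proof (rule nn_integral_mono)
      fix \<omega>
      have "1 \<le> exp (- (t * T)) * exp (t * W \<omega>)" if "T < W \<omega>"
        using t that by (simp flip: exp_add)
      then show "indicator {\<omega> \<in> space M. T < W \<omega>} \<omega> \<le> ennreal (exp (- (t * T))) * ennreal (exp (t * W \<omega>))"
        by (auto simp: indicator_def ennreal_mult'[symmetric] simp flip: ennreal_1 intro!: ennreal_leI)
    qed
    also have "\<dots> = ennreal (exp (- (t * T))) * (\<integral>\<^sup>+\<omega>. ennreal (exp (t * W \<omega>)) \<partial>M)"
      by (intro nn_integral_cmult) simp
    also have "\<dots> \<le> ennreal (exp (- (t * T))) * ennreal (exp (t * trace A + t\<^sup>2 * v / (1 - 2 * t * c)))"
      unfolding W_def v_def c_def using t gap_pos
      by (intro mult_left_mono nn_integral_exp_quadratic_le A) (auto simp: c_def)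
    also have "\<dots> = ennreal (exp (- (t * T) + (t * trace A + t\<^sup>2 * v / (1 - 2 * t * c))))"
      by (simp only: exp_add exp_ge_zero ennreal_mult'[symmetric])
    also have "- (t * T) + (t * trace A + t\<^sup>2 * v / (1 - 2 * t * c)) = - x"
      unfolding exponent[symmetric] by (simp add: T_def algebra_simps)
    finally show ?thesis by (simp add: T_def v_def c_def W_def)
  qed
qed

text \<open>
  The layer-cake formula is applied to \<open>\<surd>(\<kappa> V)\<close>, so that the tail to be integrated is
  \<open>\<xi> exp (- \<xi>)\<close>.
\<close>
lemma (in prob_space) nn_integral_le_of_exp_sqrt_tail:
  fixes V :: "'a \<Rightarrow> real"
  assumes [measurable]: "V \<in> borel_measurable M" and \<kappa>: "0 < \<kappa>" and C: "0 \<le> C"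
    and tail: "\<And>\<xi>. 0 < \<xi> \<Longrightarrow> emeasure M {\<omega> \<in> space M. \<xi>\<^sup>2 / \<kappa> < V \<omega>} \<le> ennreal (C * exp (- \<xi>))"
  shows "(\<integral>\<^sup>+\<omega>. ennreal (V \<omega>) \<partial>M) \<le> ennreal (2 * C / \<kappa>)"
proof -
  interpret pair_sigma_finite M "lborel :: real measure" by standard
  \<comment> \<open>\<open>2 * \<xi> / \<kappa>\<close> is the derivative of
    \<open>\<xi>\<^sup>2 / \<kappa>\<close>, so integrating up to
    \<open>sqrt (\<kappa> * V \<omega>)\<close> recovers \<open>V \<omega>\<close> when it is
    positive.\<close>
  let ?f = "\<lambda>\<omega> \<xi>. if 0 < \<xi> \<and> \<xi>\<^sup>2 / \<kappa> < V \<omega> then ennreal (2 * \<xi> / \<kappa>) else 0"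
  have layer: "ennreal (V \<omega>) \<le> (\<integral>\<^sup>+\<xi>. ?f \<omega> \<xi> \<partial>lborel)" for \<omega>
  proof (cases "0 < V \<omega>")
    case True
    define s where "s = sqrt (\<kappa> * V \<omega>)"
    have s: "0 < s" "s\<^sup>2 / \<kappa> = V \<omega>" using True \<kappa> by (simp_all add: s_def)
    have "(\<integral>\<^sup>+\<xi>. ennreal (2 * \<xi> / \<kappa>) * indicator {0..s} \<xi> \<partial>lborel) = s\<^sup>2 / \<kappa> - 0\<^sup>2 / \<kappa>"
      using s \<kappa> by (intro nn_integral_FTC_Icc) (auto intro!: derivative_eq_intros)
    then have "ennreal (V \<omega>) = (\<integral>\<^sup>+\<xi>. ennreal (2 * \<xi> / \<kappa>) * indicator {0..s} \<xi> \<partial>lborel)"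
      by (simp add: s)
    also have "\<dots> \<le> (\<integral>\<^sup>+\<xi>. ?f \<omega> \<xi> \<partial>lborel)"
    proof (rule nn_integral_mono_AE)
      \<comment> \<open>At the endpoint \<open>\<xi> = s\<close> the closed indicator is 1 while the
        strict inequality in \<open>?f\<close> fails; this single point is a null set.\<close>
      have "ennreal (2 * \<xi> / \<kappa>) * indicator {0..s} \<xi> \<le> ?f \<omega> \<xi>" if "\<xi> \<noteq> s" for \<xi>
      proof (cases "0 < \<xi> \<and> \<xi> < s")
        case True
        then have "\<xi>\<^sup>2 / \<kappa> < s\<^sup>2 / \<kappa>"
          using \<kappa> by (intro divide_strict_right_mono power_strict_mono) auto
        then show ?thesis using True s by (simp add: indicator_def)
      next
        case False
        then show ?thesis using that by (auto simp: indicator_def)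
      qed
      then show "AE \<xi> in lborel. ennreal (2 * \<xi> / \<kappa>) * indicator {0..s} \<xi> \<le> ?f \<omega> \<xi>"
        by (intro eventually_mono[OF AE_lborel_singleton[of s]])
    qed
    finally show ?thesis .
  qed (simp add: ennreal_neg)
  have "(\<integral>\<^sup>+\<omega>. ennreal (V \<omega>) \<partial>M) \<le> (\<integral>\<^sup>+\<omega>. (\<integral>\<^sup>+\<xi>. ?f \<omega> \<xi> \<partial>lborel) \<partial>M)"
    by (intro nn_integral_mono layer)
  also have "\<dots> = (\<integral>\<^sup>+\<xi>. (\<integral>\<^sup>+\<omega>. ?f \<omega> \<xi> \<partial>M) \<partial>lborel)"
    by (intro Fubini'[symmetric]) measurable
  also have "\<dots> \<le> (\<integral>\<^sup>+\<xi>. ennreal (2 * C / \<kappa>) * (ennreal (\<xi> ^ 1 * exp (- \<xi>)) * indicator {0..} \<xi>) \<partial>lborel)"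
  proof (rule nn_integral_mono)
    fix \<xi> :: real
    show "(\<integral>\<^sup>+\<omega>. ?f \<omega> \<xi> \<partial>M) \<le> ennreal (2 * C / \<kappa>) * (ennreal (\<xi> ^ 1 * exp (- \<xi>)) * indicator {0..} \<xi>)"
    proof (cases "0 < \<xi>")
      case True
      have "(\<integral>\<^sup>+\<omega>. ?f \<omega> \<xi> \<partial>M) = (\<integral>\<^sup>+\<omega>. ennreal (2 * \<xi> / \<kappa>) * indicator {\<omega> \<in> space M. \<xi>\<^sup>2 / \<kappa> < V \<omega>} \<omega> \<partial>M)"
        using True by (intro nn_integral_cong) (auto simp: indicator_def)
      also have "\<dots> = ennreal (2 * \<xi> / \<kappa>) * emeasure M {\<omega> \<in> space M. \<xi>\<^sup>2 / \<kappa> < V \<omega>}"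
        by (intro nn_integral_cmult_indicator) simp
      also have "\<dots> \<le> ennreal (2 * \<xi> / \<kappa>) * ennreal (C * exp (- \<xi>))"
        by (intro mult_left_mono tail True) auto
      also have "\<dots> = ennreal (2 * C / \<kappa>) * (ennreal (\<xi> ^ 1 * exp (- \<xi>)) * indicator {0..} \<xi>)"
        using True \<kappa> C by (simp add: ac_simps flip: ennreal_mult')
      finally show ?thesis .
    qed simp
  qed
  also have "\<dots> = ennreal (2 * C / \<kappa>) * (\<integral>\<^sup>+\<xi>. ennreal (\<xi> ^ 1 * exp (- \<xi>)) * indicator {0..} \<xi> \<partial>lborel)"
    by (intro nn_integral_cmult) simp
  \<comment> \<open>The remaining Gamma integral equals \<open>fact 1 = 1\<close>.\<close>
  also have "\<dots> = ennreal (2 * C / \<kappa>)"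
    by (simp only: nn_intergal_power_times_exp_Ici) simp
  finally show ?thesis .
qed

text \<open>This compares the tail threshold at level \<open>L + \<xi>\<close> with the penalty term
  plus \<open>\<xi>\<^sup>2 / \<kappa>\<close>. The root is split into an \<open>n\<close> part and
  a \<open>b\<close> part, the latter being absorbed by \<open>\<theta> * p\<close>; what grows with
  \<open>\<xi>\<close> is then at most linear with slope \<open>2 * D\<close>, and a square
  inequality trades it for \<open>\<kappa> * D\<^sup>2 + \<xi>\<^sup>2 / \<kappa>\<close>.\<close>

lemma penalty_budget:
  fixes n b r p :: real
  assumes nonneg: "0 \<le> n" "0 \<le> b" "0 \<le> r" "0 \<le> p" "0 \<le> s" and b: "b\<^sup>2 \<le> r * p"
    and pos: "0 < \<theta>" "0 < \<kappa>" "0 < L" "0 < h" "0 < \<xi>"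
  shows "2 * sqrt ((n\<^sup>2 + 2 * b\<^sup>2) * (L + \<xi>)) + 2 * s * (L + \<xi>)
    \<le> \<theta> * p + 2 * (r / \<theta> + s) * L + 2 * n * sqrt (L + h)
      + \<kappa> * (n / (sqrt L + sqrt (L + h)) + r / \<theta> + s)\<^sup>2 + \<xi>\<^sup>2 / \<kappa>"
proof -
  define x where "x = L + \<xi>"
  define D where "D = n / (sqrt L + sqrt (L + h)) + r / \<theta> + s"
  have x: "0 < x" using pos by (simp add: x_def)
  have "sqrt ((n\<^sup>2 + 2 * b\<^sup>2) * x) = sqrt (n\<^sup>2 * x + 2 * b\<^sup>2 * x)" by (simp add: distrib_right)
  also have "\<dots> \<le> sqrt (n\<^sup>2 * x) + sqrt (2 * b\<^sup>2 * x)"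
    using x by (intro sqrt_add_le_add_sqrt) auto
  also have "sqrt (n\<^sup>2 * x) = n * sqrt x" using nonneg by (simp add: real_sqrt_mult)
  \<comment> \<open>The bound on \<open>b\<^sup>2\<close> enters here. The weight \<theta> is placed
    so that the arithmetic-geometric mean inequality leaves exactly
    \<open>\<theta> * p\<close>.\<close>
  also have "sqrt (2 * b\<^sup>2 * x) \<le> sqrt ((\<theta> * p) * (2 * r * x / \<theta>))"
    using b x pos by (intro real_sqrt_le_mono) (simp add: mult.commute)
  also have "sqrt ((\<theta> * p) * (2 * r * x / \<theta>)) \<le> (\<theta> * p + 2 * r * x / \<theta>) / 2"
    using nonneg x pos by (intro arith_geo_mean_sqrt) auto
  finally have 1: "2 * sqrt ((n\<^sup>2 + 2 * b\<^sup>2) * x) \<le> 2 * (n * sqrt x) + (\<theta> * p + 2 * r * x / \<theta>)"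
    by (simp add: field_simps)
  \<comment> \<open>Up to \<open>\<xi> = h\<close> monotonicity suffices. Beyond it, rationalizing
    the difference of roots gives \<open>(\<xi> - h) / (sqrt x + sqrt (L + h))\<close>, where
    \<open>h\<close> is dropped and \<open>sqrt x\<close> is at least \<open>sqrt L\<close>.\<close>
  have "sqrt x \<le> sqrt (L + h) + \<xi> / (sqrt L + sqrt (L + h))"
  proof (cases "\<xi> \<le> h")
    case True
    then have "sqrt x \<le> sqrt (L + h)" by (simp add: x_def)
    moreover have "0 \<le> \<xi> / (sqrt L + sqrt (L + h))" using pos by simp
    ultimately show ?thesis by linarith
  next
    case False
    have "(sqrt x - sqrt (L + h)) * (sqrt x + sqrt (L + h)) = \<xi> - h"
      using x pos by (simp add: algebra_simps) (simp add: x_def)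
    moreover have "0 < sqrt x + sqrt (L + h)" using x pos by (simp add: add_pos_pos)
    ultimately have "sqrt x - sqrt (L + h) = (\<xi> - h) / (sqrt x + sqrt (L + h))"
      by (simp add: eq_divide_eq)
    also have "\<dots> \<le> \<xi> / (sqrt L + sqrt (L + h))"
      using pos x by (intro frac_le add_right_mono) (auto simp: x_def add_pos_pos)
    finally show ?thesis by simp
  qed
  from mult_left_mono[OF this nonneg(1)]
  have 2: "n * sqrt x \<le> n * sqrt (L + h) + n / (sqrt L + sqrt (L + h)) * \<xi>"
    by (simp add: distrib_left)
  have "2 * D * \<xi> \<le> \<kappa> * D\<^sup>2 + \<xi>\<^sup>2 / \<kappa>"
  proof -
    have "0 \<le> (\<kappa> * D - \<xi>)\<^sup>2 / \<kappa>" using pos by simp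
    also have "\<dots> = \<kappa> * D\<^sup>2 + \<xi>\<^sup>2 / \<kappa> - 2 * D * \<xi>"
      using pos by (simp add: power2_eq_square field_simps)
    finally show ?thesis by simp
  qed
  moreover have "2 * D * \<xi> = 2 * (n / (sqrt L + sqrt (L + h)) * \<xi>) + 2 * (r / \<theta> + s) * \<xi>"
    by (simp add: D_def algebra_simps)
  moreover have "2 * r * x / \<theta> + 2 * s * x = 2 * (r / \<theta> + s) * L + 2 * (r / \<theta> + s) * \<xi>"
    by (simp add: x_def algebra_simps add_divide_distrib)
  ultimately show ?thesis
    using 1 2 unfolding x_def[symmetric] D_def[symmetric] by linarith
qed

text \<open>In the application \<open>p\<close> is the squared norm of the bias vector
  \<open>u\<close> and \<open>r\<close> the largest singular value of the bias matrix. Taking the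
  tail at level \<open>L + \<xi>\<close> produces the factor \<open>exp (- L)\<close>, which is what
  makes the sum over all models produce \<Sigma>.\<close>

lemma (in std_normal_vector) expected_excess_le:
  assumes A: "transpose A = A" and "0 \<le> r" "0 \<le> p" and b: "(norm b)\<^sup>2 \<le> r * p"
    and pos: "0 < \<theta>" "0 < \<kappa>" "0 < L" "0 < h"
  defines "s \<equiv> largest_pos_eigenvalue A"
  defines "Q \<equiv> trace A + 2 * (r / \<theta> + s) * L + 2 * norm A * sqrt (L + h)
      + \<kappa> * (norm A / (sqrt L + sqrt (L + h)) + r / \<theta> + s)\<^sup>2"
  shows "(\<integral>\<^sup>+\<omega>. ennreal (z \<omega> \<bullet> (A *v z \<omega>) + 2 * (b \<bullet> z \<omega>) - \<theta> * p - Q) \<partial>M) \<le> ennreal (2 * exp (- L) / \<kappa>)"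
proof (rule nn_integral_le_of_exp_sqrt_tail)
  have "(\<lambda>y. y \<bullet> (A *v y) + 2 * (b \<bullet> y) - \<theta> * p - Q) \<in> borel_measurable borel"
    by (intro borel_measurable_continuous_onI continuous_intros)
  from measurable_compose[OF vector_measurable this]
  show "(\<lambda>\<omega>. z \<omega> \<bullet> (A *v z \<omega>) + 2 * (b \<bullet> z \<omega>) - \<theta> * p - Q) \<in> borel_measurable M" by simp
  fix \<xi> :: real assume \<xi>: "0 < \<xi>"
  let ?W = "\<lambda>\<omega>. z \<omega> \<bullet> (A *v z \<omega>) + 2 * (b \<bullet> z \<omega>)"
  let ?T = "trace A + 2 * sqrt (((norm A)\<^sup>2 + 2 * (norm b)\<^sup>2) * (L + \<xi>)) + 2 * s * (L + \<xi>)"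
  have budget: "?T \<le> \<theta> * p + Q + \<xi>\<^sup>2 / \<kappa>"
    unfolding Q_def s_def
    using penalty_budget[OF norm_ge_zero[of A] norm_ge_zero[of b] assms(2,3) largest_pos_eigenvalue_nonneg[of A] b pos \<xi>]
    by simp
  have "(\<lambda>y. y \<bullet> (A *v y) + 2 * (b \<bullet> y)) \<in> borel_measurable borel"
    by (intro borel_measurable_continuous_onI continuous_intros)
  from measurable_compose[OF vector_measurable this]
  have [measurable]: "?W \<in> borel_measurable M" by simp
  have "emeasure M {\<omega> \<in> space M. \<xi>\<^sup>2 / \<kappa> < ?W \<omega> - \<theta> * p - Q} \<le> emeasure M {\<omega> \<in> space M. ?T < ?W \<omega>}"
    using budget by (intro emeasure_mono) (force, measurable)
  also have "\<dots> \<le> ennreal (exp (- (L + \<xi>)))"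
    unfolding s_def using pos \<xi> by (intro quadratic_tail A) simp
  finally show "emeasure M {\<omega> \<in> space M. \<xi>\<^sup>2 / \<kappa> < ?W \<omega> - \<theta> * p - Q} \<le> ennreal (exp (- L) * exp (- \<xi>))"
    by (simp flip: exp_add)
qed (use pos in auto)

section \<open>Moments and the decomposition of the loss\<close>

context std_normal_vector
begin

lemma
  shows integrable_component: "integrable M (\<lambda>\<omega>. z \<omega> $ i)"
    and expectation_component: "expectation (\<lambda>\<omega>. z \<omega> $ i) = 0"
  using distributed_integrable[OF distributed_components[of i], of "\<lambda>x. x ^ 1"]
    distributed_integral[OF distributed_components[of i], of "\<lambda>x. x ^ 1"]
    integrable_std_normal_moment[of 1] integral_std_normal_moment_odd[of 0]
  by simp_all

lemma
  shows integrable_component_mult: "integrable M (\<lambda>\<omega>. z \<omega> $ i * z \<omega> $ j)"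
    and expectation_component_mult: "expectation (\<lambda>\<omega>. z \<omega> $ i * z \<omega> $ j) = (if i = j then 1 else 0)"
proof -
  have "integrable M (\<lambda>\<omega>. z \<omega> $ i * z \<omega> $ j) \<and>
      expectation (\<lambda>\<omega>. z \<omega> $ i * z \<omega> $ j) = (if i = j then 1 else 0)"
  proof (cases "i = j")
    case True
    then show ?thesis
      using distributed_integrable[OF distributed_components[of i], of "\<lambda>x. x ^ 2"]
        distributed_integral[OF distributed_components[of i], of "\<lambda>x. x ^ 2"]
        integrable_std_normal_moment[of 2] integral_std_normal_moment_even[of 1]
      by (simp add: power2_eq_square)
  next
    case False
    have "indep_vars (\<lambda>_. borel) (\<lambda>i \<omega>. z \<omega> $ i) {i, j}"
      by (rule indep_vars_subset[OF indep_components]) simp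
    then show ?thesis
      using False indep_vars_lebesgue_integral[of "{i, j}" "\<lambda>i \<omega>. z \<omega> $ i"]
        indep_vars_integrable[of "{i, j}" "\<lambda>i \<omega>. z \<omega> $ i"]
      by (simp add: integrable_component expectation_component)
  qed
  then show "integrable M (\<lambda>\<omega>. z \<omega> $ i * z \<omega> $ j)"
    and "expectation (\<lambda>\<omega>. z \<omega> $ i * z \<omega> $ j) = (if i = j then 1 else 0)" by simp_all
qed

lemma
  shows integrable_linear_form: "integrable M (\<lambda>\<omega>. b \<bullet> z \<omega>)"
    and expectation_linear_form: "expectation (\<lambda>\<omega>. b \<bullet> z \<omega>) = 0"
  by (simp_all add: inner_vec_def integrable_component expectation_component)

lemma quadratic_form_eq_sum:
  fixes A :: "real^'n^'n"
  shows "x \<bullet> (A *v x) = (\<Sum>i\<in>UNIV. \<Sum>j\<in>UNIV. A $ i $ j * (x $ i * x $ j))"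
  by (simp add: inner_vec_def matrix_vector_mult_def sum_distrib_left ac_simps)

lemma
  shows integrable_quadratic_form: "integrable M (\<lambda>\<omega>. z \<omega> \<bullet> (A *v z \<omega>))"
    and expectation_quadratic_form: "expectation (\<lambda>\<omega>. z \<omega> \<bullet> (A *v z \<omega>)) = trace A"
  unfolding quadratic_form_eq_sum
  by (simp_all add: integrable_component_mult expectation_component_mult trace_def if_distrib cong: if_cong)

end

section \<open>Matrix identities behind the loss decomposition\<close>

lemma inner_transpose_mult_vector:
  fixes A :: "real^'m^'n"
  shows "x \<bullet> (transpose A *v y) = (A *v x) \<bullet> y"
  by (metis dot_lmul_matrix inner_commute transpose_matrix_vector)

lemma transpose_add: "transpose (A + B) = transpose A + transpose B"
  and transpose_diff: "transpose (A - B) = transpose A - transpose (B :: 'a::ab_group_add^'n^'m)"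
  by (simp_all add: transpose_def vec_eq_iff)

text \<open>Summing quadratic forms over the standard basis lets the trace formulas below follow
  from the pointwise identities for the same matrices.\<close>

lemma trace_eq_sum_axis:
  fixes A :: "real^'n^'n"
  shows "trace A = (\<Sum>i\<in>UNIV. axis i 1 \<bullet> (A *v axis i 1))"
  by (simp add: trace_def inner_axis' matrix_vector_mult_basis column_def)

lemma noise_matrix_eq:
  "noise_matrix \<theta> X R \<Psi> =
    transpose R ** (- \<theta> *\<^sub>R (transpose (X ** \<Psi>) ** (X ** \<Psi>)) + X ** \<Psi> + transpose (X ** \<Psi>)) ** R"
  by (simp add: noise_matrix_def matrix_transpose_mul matrix_mul_assoc)

lemma transpose_noise_matrix: "transpose (noise_matrix \<theta> X R \<Psi>) = noise_matrix \<theta> X R \<Psi>"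
  unfolding noise_matrix_eq
  by (simp only: matrix_transpose_mul transpose_add transpose_scalar transpose_transpose matrix_mul_assoc add.assoc)
    (simp add: add.commute)

lemma transpose_bias_matrix: "transpose (bias_matrix \<theta> X R \<Psi>) = bias_matrix \<theta> X R \<Psi>"
  by (simp add: bias_matrix_def matrix_transpose_mul matrix_mul_assoc)

lemma inner_noise_matrix:
  "x \<bullet> (noise_matrix \<theta> X R \<Psi> *v x) =
    2 * ((R *v x) \<bullet> ((X ** \<Psi>) *v (R *v x))) - \<theta> * (norm ((X ** \<Psi>) *v (R *v x)))\<^sup>2"
  unfolding noise_matrix_eq
  by (simp add: matrix_vector_mult_add_rdistrib matrix_vector_mult_diff_rdistrib inner_diff_right inner_transpose_mult_vector inner_add_right
      inner_commute dot_square_norm del: transpose_matrix_vector flip: matrix_vector_mul_assoc scaleR_matrix_vector_assoc)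

lemma inner_crit_matrix:
  "x \<bullet> (crit_matrix X \<Psi> *v x) = (norm ((X ** \<Psi>) *v x))\<^sup>2 - 2 * (x \<bullet> ((X ** \<Psi>) *v x))"
proof -
  have "crit_matrix X \<Psi> = transpose (X ** \<Psi>) ** (X ** \<Psi>) - 2 *\<^sub>R (X ** \<Psi>)"
    by (simp add: crit_matrix_def matrix_transpose_mul matrix_mul_assoc)
  then show ?thesis
    by (simp add: matrix_vector_mult_diff_rdistrib inner_transpose_mult_vector inner_diff_right
      dot_square_norm del: transpose_matrix_vector flip: matrix_vector_mul_assoc scaleR_matrix_vector_assoc)
qed

text \<open>The bias matrix is \<open>N ** transpose N\<close>. At \<open>x = u\<close> the
  right-hand norm is that of the linear coefficient \<open>b\<close> of the noise, so the largest
  singular value controls \<open>b\<close> by \<open>u\<close>.\<close>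

lemma inner_bias_matrix:
  "x \<bullet> (bias_matrix \<theta> X R \<Psi> *v x) = (norm (transpose R *v (x - \<theta> *\<^sub>R (transpose (X ** \<Psi>) *v x))))\<^sup>2"
proof -
  define N where "N = (\<theta> *\<^sub>R (X ** \<Psi>) - mat 1) ** R"
  have "bias_matrix \<theta> X R \<Psi> = N ** transpose N"
    by (simp add: bias_matrix_def N_def matrix_transpose_mul matrix_mul_assoc)
  then have "x \<bullet> (bias_matrix \<theta> X R \<Psi> *v x) = (norm (transpose N *v x))\<^sup>2"
    using inner_transpose_mult_vector[of x "transpose N" "transpose N *v x"]
    by (simp add: transpose_transpose dot_square_norm del: transpose_matrix_vector flip: matrix_vector_mul_assoc)
  also have "transpose N *v x = - (transpose R *v (x - \<theta> *\<^sub>R (transpose (X ** \<Psi>) *v x)))"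
    by (simp add: N_def matrix_transpose_mul transpose_diff transpose_scalar transpose_mat
        matrix_vector_mult_diff_rdistrib matrix_vector_mult_diff_distrib
        del: transpose_matrix_vector flip: matrix_vector_mul_assoc scaleR_matrix_vector_assoc)
  finally show ?thesis by simp
qed

lemma norm_matrix_sum_axis:
  fixes A :: "real^'p^'n"
  shows "(norm A)\<^sup>2 = (\<Sum>i\<in>UNIV. (norm (A *v axis i 1))\<^sup>2)"
  unfolding norm_matrix_trace trace_eq_sum_axis
  by (simp add: inner_transpose_mult_vector dot_square_norm del: transpose_matrix_vector flip: matrix_vector_mul_assoc)

lemma trace_noise_matrix:
  "trace (noise_matrix \<theta> X R \<Psi>) = 2 * trace (transpose R ** X ** \<Psi> ** R) - \<theta> * (norm (X ** \<Psi> ** R))\<^sup>2"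
  unfolding trace_eq_sum_axis norm_matrix_sum_axis inner_noise_matrix
  by (simp add: inner_transpose_mult_vector sum_subtractf sum_distrib_left del: transpose_matrix_vector flip: matrix_vector_mul_assoc)

lemma trace_crit_matrix:
  "trace (transpose R ** crit_matrix X \<Psi> ** R) = (norm (X ** \<Psi> ** R))\<^sup>2 - 2 * trace (transpose R ** X ** \<Psi> ** R)"
  unfolding trace_eq_sum_axis norm_matrix_sum_axis
  using inner_crit_matrix[of _ X \<Psi>]
  by (simp add: inner_transpose_mult_vector sum_subtractf sum_distrib_left del: transpose_matrix_vector flip: matrix_vector_mul_assoc)

text \<open>Put \<open>K = X ** \<Psi>\<close> and \<open>w = R *v x\<close>. One full copy of the
  loss is the criterion form plus \<open>(norm f)\<^sup>2\<close> and twice the inner product of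
  \<open>w\<close> with \<open>K *v (f + w)\<close>. Since the error is \<open>u + K *v w\<close>,
  subtracting \<theta> copies supplies the negative terms, among them the
  \<open>- \<theta> * (norm u)\<^sup>2\<close> that later pays for the linear noise.\<close>

lemma loss_decomposition:
  fixes f x :: "real^'n" and X :: "real^'p^'n" and \<Psi> :: "real^'n^'p"
  defines "u \<equiv> (X ** \<Psi>) *v f - f"
  shows "(1 - \<theta>) * (norm ((X ** \<Psi>) *v (f + R *v x) - f))\<^sup>2
    = (f + R *v x) \<bullet> (crit_matrix X \<Psi> *v (f + R *v x)) + (norm f)\<^sup>2 + 2 * (f \<bullet> (R *v x))
      + (x \<bullet> (noise_matrix \<theta> X R \<Psi> *v x)
          + 2 * ((transpose R *v (u - \<theta> *\<^sub>R (transpose (X ** \<Psi>) *v u))) \<bullet> x) - \<theta> * (norm u)\<^sup>2)"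
proof -
  define w where "w = R *v x"
  define a where "a = (X ** \<Psi>) *v f"
  define k where "k = (X ** \<Psi>) *v w"
  have lin: "(transpose R *v (u - \<theta> *\<^sub>R (transpose (X ** \<Psi>) *v u))) \<bullet> x = u \<bullet> w - \<theta> * (u \<bullet> k)"
    unfolding inner_commute[of _ x] inner_transpose_mult_vector w_def[symmetric]
    by (simp add: inner_diff_right inner_transpose_mult_vector inner_commute[of u] k_def del: transpose_matrix_vector)
  show ?thesis
    unfolding inner_crit_matrix inner_noise_matrix lin
    unfolding u_def w_def[symmetric] matrix_vector_right_distrib a_def[symmetric] k_def[symmetric]
    unfolding power2_norm_eq_inner
    by (simp add: inner_add_left inner_add_right inner_diff_left inner_diff_right inner_commute algebra_simps)
qed

section \<open>Risk bound for the selected estimator\<close>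

theorem theorem2:
  fixes \<Omega> :: "'w measure"
    and \<beta> :: "real^'p" and X :: "real^'p^'n" and R :: "real^'n^'n"
    and z y :: "'w \<Rightarrow> real^'n"
    and \<M> :: "'m set" and \<Psi> :: "'m \<Rightarrow> real^'n^'p"
    and L h pen :: "'m \<Rightarrow> real" and \<theta> \<kappa> :: real
    and m_sel :: "'w \<Rightarrow> 'm"
  assumes "prob_space \<Omega>"
    and "prob_space.indep_vars \<Omega> (\<lambda>_. borel) (\<lambda>i \<omega>. z \<omega> $ i) UNIV"
    and "\<And>i. distributed \<Omega> lborel (\<lambda>\<omega>. z \<omega> $ i) std_normal_density"
    and "\<And>\<omega>. y \<omega> = X *v \<beta> + R *v z \<omega>"
    and "finite \<M>" and "\<M> \<noteq> {}"
    and "0 < \<theta>" and "\<theta> < 1" and "0 < \<kappa>"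
    and "\<And>m. m \<in> \<M> \<Longrightarrow> 0 < L m"
    and "\<And>m. m \<in> \<M> \<Longrightarrow> 0 < h m"
    and "m_sel \<in> measurable \<Omega> (count_space \<M>)"
    and "\<And>\<omega>. \<omega> \<in> space \<Omega> \<Longrightarrow>
           is_arg_min (\<lambda>m. crit X (\<Psi> m) (pen m) (y \<omega>)) (\<lambda>m. m \<in> \<M>) (m_sel \<omega>)"
  shows "integrable \<Omega> (\<lambda>\<omega>. (norm (X *v (\<Psi> (m_sel \<omega>) *v y \<omega>) - X *v \<beta>))\<^sup>2) \<and>
    (1 - \<theta>) * (\<integral>\<omega>. (norm (X *v (\<Psi> (m_sel \<omega>) *v y \<omega>) - X *v \<beta>))\<^sup>2 \<partial>\<Omega>)
      \<le> (INF m\<in>\<M>. (norm (X *v \<beta>))\<^sup>2 + (X *v \<beta>) \<bullet> (crit_matrix X (\<Psi> m) *v (X *v \<beta>))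
            + (norm (X ** \<Psi> m ** R))\<^sup>2 - 2 * trace (transpose R ** X ** \<Psi> m ** R) + pen m)
        + (SUP m\<in>\<M>. Q_bound \<theta> \<kappa> X R (\<Psi> m) (L m) (h m) - pen m)
        + 2 * (\<Sum>m\<in>\<M>. exp (- L m)) / \<kappa>"
proof -
  interpret std_normal_vector \<Omega> z
    using assms(1-3) by (simp add: std_normal_vector_def std_normal_vector_axioms_def)
  define f where "f = X *v \<beta>"
  have y: "y \<omega> = f + R *v z \<omega>" for \<omega>
    by (simp add: assms(4) f_def)
  define loss where "loss m \<omega> = (norm ((X ** \<Psi> m) *v y \<omega> - f))\<^sup>2" for m \<omega>
  have loss_eq: "(norm (X *v (\<Psi> m *v y \<omega>) - X *v \<beta>))\<^sup>2 = loss m \<omega>" for m \<omega>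
    by (simp add: loss_def f_def matrix_vector_mul_assoc)
  define A where "A m = noise_matrix \<theta> X R (\<Psi> m)" for m
  define u where "u m = (X ** \<Psi> m) *v f - f" for m
  define b where "b m = transpose R *v (u m - \<theta> *\<^sub>R (transpose (X ** \<Psi> m) *v u m))" for m
  define r where "r m = largest_singular_value (bias_matrix \<theta> X R (\<Psi> m))" for m
  define Q where "Q m = Q_bound \<theta> \<kappa> X R (\<Psi> m) (L m) (h m)" for m
  \<comment> \<open>The excess of the model-dependent fluctuation over its allowance
    \<open>Q m\<close>; only its positive part has to be controlled.\<close>
  define V where "V m \<omega> = z \<omega> \<bullet> (A m *v z \<omega>) + 2 * (b m \<bullet> z \<omega>) - \<theta> * (norm (u m))\<^sup>2 - Q m" for m \<omega>
  define quad where "quad m \<omega> = y \<omega> \<bullet> (crit_matrix X (\<Psi> m) *v y \<omega>)" for m \<omega>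
  have decomp: "(1 - \<theta>) * loss m \<omega> = quad m \<omega> + (norm f)\<^sup>2 + 2 * (f \<bullet> (R *v z \<omega>)) + V m \<omega> + Q m" for m \<omega>
    unfolding loss_def quad_def y loss_decomposition V_def A_def b_def u_def by simp

  have R_form: "g \<bullet> (R *v z \<omega>) = (transpose R *v g) \<bullet> z \<omega>" for g \<omega>
    using inner_transpose_mult_vector[of "z \<omega>" R g] by (simp only: inner_commute)
  \<comment> \<open>Expansion around \<open>f\<close> into constant, centred linear and quadratic
    parts; the last has a trace as its mean. The transpose is present because
    \<open>crit_matrix\<close> need not be symmetric.\<close>
  have quad_eq: "quad m \<omega> = f \<bullet> (crit_matrix X (\<Psi> m) *v f)
      + (transpose R *v (transpose (crit_matrix X (\<Psi> m)) *v f + crit_matrix X (\<Psi> m) *v f)) \<bullet> z \<omega>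
      + z \<omega> \<bullet> ((transpose R ** crit_matrix X (\<Psi> m) ** R) *v z \<omega>)" for m \<omega>
    unfolding R_form[symmetric] quad_def y
    by (simp add: matrix_vector_right_distrib inner_add_left inner_add_right inner_transpose_mult_vector
        inner_commute[of _ "R *v z \<omega>"] inner_commute[of f] del: transpose_matrix_vector flip: matrix_vector_mul_assoc)
  have quad_integrable: "integrable \<Omega> (quad m)" for m
    unfolding quad_eq[abs_def]
    by (intro Bochner_Integration.integrable_add integrable_linear_form integrable_quadratic_form) simp
  have quad_expectation: "expectation (quad m) = f \<bullet> (crit_matrix X (\<Psi> m) *v f)
      + (norm (X ** \<Psi> m ** R))\<^sup>2 - 2 * trace (transpose R ** X ** \<Psi> m ** R)" for m
    unfolding quad_eq[abs_def]
    by (simp add: integrable_linear_form integrable_quadratic_form expectation_linear_form expectation_quadratic_form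
        trace_crit_matrix prob_space del: transpose_matrix_vector)

  have V_integrable: "integrable \<Omega> (V m)" for m
    unfolding V_def[abs_def]
    by (intro Bochner_Integration.integrable_add Bochner_Integration.integrable_diff integrable_mult_right
        integrable_linear_form integrable_quadratic_form) simp_all
  have excess: "expectation (\<lambda>\<omega>. max 0 (V m \<omega>)) \<le> 2 * exp (- L m) / \<kappa>" if m: "m \<in> \<M>" for m
  proof -
    have "(norm (b m))\<^sup>2 \<le> r m * (norm (u m))\<^sup>2"
      unfolding b_def r_def inner_bias_matrix[symmetric]
      by (rule inner_le_largest_singular_value[OF transpose_bias_matrix])
    moreover have "0 \<le> r m"
      unfolding r_def by (rule largest_singular_value_nonneg[OF transpose_bias_matrix])
    ultimately have "(\<integral>\<^sup>+\<omega>. ennreal (V m \<omega>) \<partial>\<Omega>) \<le> ennreal (2 * exp (- L m) / \<kappa>)"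
      using expected_excess_le[of "A m" "r m" "(norm (u m))\<^sup>2" "b m" \<theta> \<kappa> "L m" "h m"] assms m
      by (simp add: V_def Q_def Q_bound_def Let_def A_def r_def transpose_noise_matrix trace_noise_matrix)
    \<comment> \<open>\<open>ennreal\<close> sends negative values to 0, so the bound already
      concerns the positive part.\<close>
    also have "(\<integral>\<^sup>+\<omega>. ennreal (V m \<omega>) \<partial>\<Omega>) = (\<integral>\<^sup>+\<omega>. ennreal (max 0 (V m \<omega>)) \<partial>\<Omega>)"
      by (intro nn_integral_cong) (simp add: max_def ennreal_neg)
    also have "\<dots> = ennreal (expectation (\<lambda>\<omega>. max 0 (V m \<omega>)))"
      by (intro nn_integral_eq_integral integrable_max V_integrable) simp_all
    finally show ?thesis
      using \<open>0 < \<kappa>\<close> by (simp add: ennreal_le_iff)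
  qed

  have sel: "m_sel \<omega> \<in> \<M>" if "\<omega> \<in> space \<Omega>" for \<omega>
    using assms(13)[OF that] by (simp add: is_arg_min_def)
  have loss_integrable: "integrable \<Omega> (loss m)" for m
  proof -
    have "integrable \<Omega> (\<lambda>\<omega>. (quad m \<omega> + (norm f)\<^sup>2 + 2 * (f \<bullet> (R *v z \<omega>)) + V m \<omega> + Q m) / (1 - \<theta>))"
      unfolding R_form
      by (intro integrable_divide Bochner_Integration.integrable_add integrable_mult_right
          integrable_linear_form quad_integrable V_integrable) simp_all
    then show ?thesis
      using \<open>\<theta> < 1\<close> by (simp flip: decomp)
  qed
  \<comment> \<open>The loss at the random index is dominated by the sum of the losses over the
    finite collection, each of which is integrable.\<close>
  have sel_integrable: "integrable \<Omega> (\<lambda>\<omega>. loss (m_sel \<omega>) \<omega>)"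
  proof (rule Bochner_Integration.integrable_bound)
    show "integrable \<Omega> (\<lambda>\<omega>. \<Sum>m\<in>\<M>. loss m \<omega>)"
      by (intro Bochner_Integration.integrable_sum loss_integrable)
    show "(\<lambda>\<omega>. loss (m_sel \<omega>) \<omega>) \<in> borel_measurable \<Omega>"
      by (rule measurable_compose_countable'[OF borel_measurable_integrable[OF loss_integrable] assms(12)])
        (rule countable_finite[OF assms(5)])
    have "loss (m_sel \<omega>) \<omega> \<le> (\<Sum>m\<in>\<M>. loss m \<omega>)" if "\<omega> \<in> space \<Omega>" for \<omega>
      using sel[OF that] \<open>finite \<M>\<close> by (intro member_le_sum) (auto simp: loss_def)
    then show "AE \<omega> in \<Omega>. norm (loss (m_sel \<omega>) \<omega>) \<le> norm (\<Sum>m\<in>\<M>. loss m \<omega>)"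
      by (intro AE_I2) (simp add: loss_def sum_nonneg)
  qed

  define S where "S = (SUP m\<in>\<M>. Q m - pen m)"
  define E where "E m = (norm f)\<^sup>2 + f \<bullet> (crit_matrix X (\<Psi> m) *v f)
      + (norm (X ** \<Psi> m ** R))\<^sup>2 - 2 * trace (transpose R ** X ** \<Psi> m ** R) + pen m" for m
  have bound: "(1 - \<theta>) * expectation (\<lambda>\<omega>. loss (m_sel \<omega>) \<omega>) - S - 2 * (\<Sum>m\<in>\<M>. exp (- L m)) / \<kappa> \<le> E m"
    if m: "m \<in> \<M>" for m
  proof -
    \<comment> \<open>An upper bound free of the selected index: minimality replaces its criterion
      by that of \<open>m\<close>, \<open>S\<close> absorbs \<open>Q\<close> minus the penalty, and
      the sum of all positive parts dominates the one selected.\<close>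
    define G where "G \<omega> = quad m \<omega> + pen m + (norm f)\<^sup>2 + 2 * (f \<bullet> (R *v z \<omega>)) + (\<Sum>k\<in>\<M>. max 0 (V k \<omega>)) + S" for \<omega>
    have G_integrable: "integrable \<Omega> G"
      unfolding G_def[abs_def] R_form
      by (intro Bochner_Integration.integrable_add Bochner_Integration.integrable_sum integrable_max integrable_mult_right
          integrable_linear_form quad_integrable V_integrable) simp_all
    have "(1 - \<theta>) * loss (m_sel \<omega>) \<omega> \<le> G \<omega>" if \<omega>: "\<omega> \<in> space \<Omega>" for \<omega>
    proof -
      let ?s = "m_sel \<omega>"
      have "quad ?s \<omega> + pen ?s \<le> quad m \<omega> + pen m"
        using assms(13)[OF \<omega>] m by (auto simp: is_arg_min_def crit_def quad_def not_less)
      moreover have "Q ?s - pen ?s \<le> S"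
        unfolding S_def using sel[OF \<omega>] \<open>finite \<M>\<close> by (intro cSUP_upper) auto
      moreover have "max 0 (V ?s \<omega>) \<le> (\<Sum>k\<in>\<M>. max 0 (V k \<omega>))"
        using sel[OF \<omega>] \<open>finite \<M>\<close> by (intro member_le_sum) auto
      ultimately show ?thesis
        unfolding decomp G_def by linarith
    qed
    then have "expectation (\<lambda>\<omega>. (1 - \<theta>) * loss (m_sel \<omega>) \<omega>) \<le> expectation G"
      by (intro integral_mono integrable_mult_right sel_integrable G_integrable)
    also have "expectation G = E m + (\<Sum>k\<in>\<M>. expectation (\<lambda>\<omega>. max 0 (V k \<omega>))) + S"
      unfolding G_def[abs_def] R_form E_def
      by (simp add: quad_integrable V_integrable integrable_linear_form expectation_linear_form quad_expectation
          prob_space del: transpose_matrix_vector)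
    also have "(\<Sum>k\<in>\<M>. expectation (\<lambda>\<omega>. max 0 (V k \<omega>))) \<le> (\<Sum>k\<in>\<M>. 2 * exp (- L k) / \<kappa>)"
      by (intro sum_mono excess)
    also have "\<dots> = 2 * (\<Sum>k\<in>\<M>. exp (- L k)) / \<kappa>"
      by (simp add: sum_distrib_left sum_divide_distrib)
    finally show ?thesis by simp
  qed
  have "(1 - \<theta>) * expectation (\<lambda>\<omega>. loss (m_sel \<omega>) \<omega>) - S - 2 * (\<Sum>m\<in>\<M>. exp (- L m)) / \<kappa> \<le> (INF m\<in>\<M>. E m)"
    by (intro cINF_greatest \<open>\<M> \<noteq> {}\<close> bound)
  then show ?thesis
    unfolding loss_eq using sel_integrable by (simp add: S_def Q_def E_def f_def)
qed

end
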